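(* Let $\Lambda$, $\gamma_i(n)$, $\xi_i,\eta_i$, the arrays $\mathrm B,\Theta,\mathrm E,\mathrm T$ and the generator $\mathbf R$ be as in the context. Fix $N\in\mathbb Z_+$ and set $$\Xi_{N,\Lambda}=\sum_{\substack{\underline y\in\{0,1\}^\Lambda,\ \underline n\in\mathbb Z_+^\Lambda:\\ |\underline n|=N}}\ \prod_{q\in\Lambda}\left[\frac{\xi_q}{\eta_q}\overline\gamma_q(n_q)\right]^{y_q}.$$ If $\Xi_{N,\Lambda}<\infty$, then the continuous-time Markov process on $\{(\underline y,\underline n)\in\{0,1\}^\Lambda\times\mathbb Z_+^\Lambda:\ |\underline n|=N\}$ with generator $\mathbf R$ is positive recurrent and reversible. Its stationary probabilities are $$\pi(\underline y,\underline n)=\frac{\mathbf 1(|\underline n|=N)}{\Xi_{N,\Lambda}}\prod_{q\in\Lambda}\left[\frac{\xi_q}{\eta_q}\overline\gamma_q(n_q)\right]^{y_q}.$$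
   Context: $\Lambda$ is a finite set of sites and $\mathbb Z_+=\{0,1,2,\dots\}$. A state is $(\underline y,\underline n)$ with $\underline y=(y_s)_{s\in\Lambda}\in\{0,1\}^\Lambda$ (configuration of sites occupied by distinguished customers) and $\underline n=(n_i)_{i\in\Lambda}\in\mathbb Z_+^\Lambda$ (numbers of tasks). $|\underline n|=\sum_sn_s$; write $j\in\underline y$ if $y_j=1$ and $j\notin\underline y$ if $y_j=0$. $\underline e^i$ is the unit vector at $i$, $\underline e^{i\to k}=\underline e^k-\underline e^i$, and $\mathbf 1$ is the indicator. The values $\gamma_i(n)\ge0$, $i\in\Lambda$, $n\in\mathbb Z_+$, satisfy $\gamma_i(0)=1$ and $\gamma_i(n)>0$ whenever $\gamma_i(n+1)>0$. Set $\overline\gamma_i(0)=1$, $\overline\gamma_i(n)=\prod_{0\le m<n}\gamma_i(m)$ for $n\ge1$. It is understood that $\overline\gamma_j(n_j)>0$ wherever its reciprocal appears below. The numbers $\xi_k>0$, $\eta_k>0$, $k\in\Lambda$, do not depend on $\underline n,\underline y$. The collections $\mathrm B(\underline n;\underline y)=(\beta_{kl}(n_k,n_l;\underline y))$, $\Theta(\underline n;\underline y)=(\theta_{kl}(n_k,n_l;\underline y))$, $\mathrm E(\underline n;\underline y)=(\epsilon_{ij}(n_i,n_j;\underline y))$, $\mathrm T(\underline n;\underline y)=(\tau_{jj'}(\underline n;\underline y))$ are irreducible, meaning that their off-diagonal entries are strictly positive. They satisfy: $$\beta_{kl}(n_k,n_l;\underline y)=\beta_{lk}(n_l+1,n_k-1;\underline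 y),\quad k\ne l,\ k,l\notin\underline y,\ n_k\ge1;$$ $$\theta_{jk}(n_j,n_k;\underline y)=\theta_{kj}(n_k+1,n_j-1;\underline y),\quad j\in\underline y,\ k\notin\underline y,\ n_j\ge1;$$ $$\epsilon_{ij}(n_i,n_j;\underline y)\gamma_i(n_i-1)=\gamma_j(n_j)\epsilon_{ji}(n_j+1,n_i-1;\underline y),\quad i\ne j,\ i,j\in\underline y,\ n_i\ge1;$$ $$\tau_{jj'}(\underline n;\underline y)\frac{\xi_j}{\eta_j}=\tau_{j'j}(\underline n;\underline y+\underline e^{j\to j'})\frac{\xi_{j'}}{\eta_{j'}},\quad j\in\underline y,\ j'\notin\underline y.$$ The generator $\mathbf R$ has the following off-diagonal entries (all others are zero): - $R[(\underline y,\underline n);(\underline y,\underline n+\underline e^{k\to l})]=\beta_{kl}(n_k,n_l;\underline y)\mathbf 1(n_k\ge1)$, $k\ne l$, $k,l\notin\underline y$; - $R[(\underline y,\underline n);(\underline y,\underline n+\underline e^{i\to j})]=\epsilon_{ij}(n_i,n_j;\underline y)\mathbf 1(n_i\ge1)$, $i\ne j$, $i,j\in\underline y$; - $R[(\underline y,\underline n);(\underline y,\underline n+\underline e^{j\to l})]=\theta_{jl}(n_j,n_l;\underline y)\mathbf 1(n_j\ge1)$, $j\in\underline y$, $l\notin\underline y$; - $R[(\underline y,\underline n);(\underline y,\underline n+\underline e^{k\to j})]=\theta_{kj}(n_k,n_j;\underline y)\gamma_j(n_j)\mathbf 1(n_k\ge1)$, $j\in\underline y$, $k\notin\underline y$;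 - $R[(\underline y,\underline n);(\underline y+\underline e^{j\to j'},\underline n)]=[\overline\gamma_j(n_j)]^{-1}\tau_{jj'}(\underline n;\underline y)$, $j\in\underline y$, $j'\notin\underline y$; - $R[(\underline y,\underline n);(\underline y+\underline e^k,\underline n)]=\xi_k\overline\gamma_k(n_k)\mathbf 1(y_k=0)$ and $R[(\underline y,\underline n);(\underline y-\underline e^i,\underline n)]=\eta_i\mathbf 1(y_i=1)$, $k,i\in\Lambda$.
   Formalization: If Λ has a single site, it is additionally assumed that γ̄(N)>0; otherwise the rate ξγ̄(N) into the occupied state is 0, that state is transient, and positive recurrence fails. Λ is taken nonempty. *)

theory Defs
  imports "HOL-Probability.Probability"
begin

section \<open>Continuous-time Markov processes on a finite state space\<close>

text \<open>
  The rows of \<open>generator S r\<close> indexed by \<open>S\<close> sum to zero over \<open>S\<close>; the off-diagonal entries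
  are the jump rates \<open>r\<close>.
\<close>

definition generator :: "'a set \<Rightarrow> ('a \<Rightarrow> 'a \<Rightarrow> real) \<Rightarrow> 'a \<Rightarrow> 'a \<Rightarrow> real" where
  "generator S r x z = (if x = z then - (\<Sum>w\<in>S - {x}. r x w) else r x z)"

primrec matrix_power :: "'a set \<Rightarrow> ('a \<Rightarrow> 'a \<Rightarrow> real) \<Rightarrow> nat \<Rightarrow> 'a \<Rightarrow> 'a \<Rightarrow> real" where
  "matrix_power S Q 0 = (\<lambda>x z. of_bool (x = z))"
| "matrix_power S Q (Suc k) = (\<lambda>x z. \<Sum>w\<in>S. Q x w * matrix_power S Q k w z)"

text \<open>The transition function \<open>exp (t Q)\<close>.\<close>

definition transition :: "'a set \<Rightarrow> ('a \<Rightarrow> 'a \<Rightarrow> real) \<Rightarrow> real \<Rightarrow> 'a \<Rightarrow> 'a \<Rightarrow> real" where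
  "transition S Q t x z = (\<Sum>k. t ^ k / fact k * matrix_power S Q k x z)"

text \<open>
  The probability that a process which is in \<open>x\<close> at time \<open>s\<close> visits the successive states of the
  list at the successive times of the list.
\<close>

primrec path_probability ::
    "'a set \<Rightarrow> ('a \<Rightarrow> 'a \<Rightarrow> real) \<Rightarrow> (real \<times> 'a) list \<Rightarrow> real \<Rightarrow> 'a \<Rightarrow> real" where
  "path_probability S Q [] = (\<lambda>s x. 1)"
| "path_probability S Q (p # ps) = (\<lambda>s x.
     transition S Q (fst p - s) x (snd p) * path_probability S Q ps (fst p) (snd p))"

text \<open>
  \<open>P x\<close> is the law of the process started in \<open>x\<close>, on a common measurable space whose carrier and
  events are those of \<open>\<Omega>\<close> (the measure carried by \<open>\<Omega>\<close> itself plays no role). The finite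
  dimensional distributions are those determined by \<open>exp (t Q)\<close>, and the paths are right-continuous
  for the discrete topology on \<open>S\<close>. Taking time 0 in the last clause gives that
  \<open>X 0 = x\<close> holds \<open>P x\<close>-almost surely.
\<close>

definition markov_process ::
    "'a set \<Rightarrow> ('a \<Rightarrow> 'a \<Rightarrow> real) \<Rightarrow> 'w measure \<Rightarrow> ('a \<Rightarrow> 'w measure) \<Rightarrow> (real \<Rightarrow> 'w \<Rightarrow> 'a) \<Rightarrow> bool"
where
  "markov_process S Q \<Omega> P X \<longleftrightarrow>
     finite S \<and>
     (\<forall>x\<in>S. prob_space (P x) \<and> sets (P x) = sets \<Omega>) \<and>
     (\<forall>t\<ge>0. X t \<in> measurable \<Omega> (count_space S)) \<and>
     (\<forall>\<omega>\<in>space \<Omega>. \<forall>t\<ge>0. \<forall>\<^sub>F s in at_right t. X s \<omega> = X t \<omega>) \<and>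
     (\<forall>x\<in>S. \<forall>ps. sorted (map fst ps) \<longrightarrow> (\<forall>(t, z)\<in>set ps. 0 \<le> t \<and> z \<in> S) \<longrightarrow>
        measure (P x) {\<omega>\<in>space \<Omega>. \<forall>(t, z)\<in>set ps. X t \<omega> = z} = path_probability S Q ps 0 x)"

text \<open>
  For a right-continuous path started in \<open>x\<close> this is the infimum of the times \<open>t\<close> not earlier than
  the first jump at which the path is in \<open>x\<close>; it is infinite if there is no such time.
\<close>

definition return_time :: "(real \<Rightarrow> 'w \<Rightarrow> 'a) \<Rightarrow> 'a \<Rightarrow> 'w \<Rightarrow> ennreal" where
  "return_time X x \<omega> =
     (INF t\<in>{t. 0 \<le> t \<and> X t \<omega> = x \<and> (\<exists>s\<in>{0..t}. X s \<omega> \<noteq> x)}. ennreal t)"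

text \<open>Absorbing states, which are never left, count as positive recurrent.\<close>

definition positive_recurrent ::
    "'a set \<Rightarrow> ('a \<Rightarrow> 'a \<Rightarrow> real) \<Rightarrow> ('a \<Rightarrow> 'w measure) \<Rightarrow> (real \<Rightarrow> 'w \<Rightarrow> 'a) \<Rightarrow> bool" where
  "positive_recurrent S Q P X \<longleftrightarrow>
     (\<forall>x\<in>S. Q x x = 0 \<or> (\<integral>\<^sup>+ \<omega>. return_time X x \<omega> \<partial>P x) < \<infinity>)"

text \<open>The probability of the event \<open>A\<close> for the process with initial distribution \<open>\<mu>\<close>.\<close>

definition prob_from :: "'a set \<Rightarrow> ('a \<Rightarrow> 'w measure) \<Rightarrow> ('a \<Rightarrow> real) \<Rightarrow> 'w set \<Rightarrow> real" where
  "prob_from S P \<mu> A = (\<Sum>x\<in>S. \<mu> x * measure (P x) A)"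

definition stationary_distribution ::
    "'a set \<Rightarrow> 'w measure \<Rightarrow> ('a \<Rightarrow> 'w measure) \<Rightarrow> (real \<Rightarrow> 'w \<Rightarrow> 'a) \<Rightarrow> ('a \<Rightarrow> real) \<Rightarrow> bool" where
  "stationary_distribution S \<Omega> P X \<mu> \<longleftrightarrow>
     (\<forall>x. 0 \<le> \<mu> x) \<and> (\<forall>x. x \<notin> S \<longrightarrow> \<mu> x = 0) \<and> (\<Sum>x\<in>S. \<mu> x) = 1 \<and>
     (\<forall>t\<ge>0. \<forall>z\<in>S. prob_from S P \<mu> {\<omega>\<in>space \<Omega>. X t \<omega> = z} = \<mu> z)"

text \<open>
  Started from \<open>\<mu>\<close>, the process and its time reversal from any time \<open>T\<close> have the same finite
  dimensional distributions.
\<close>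

definition reversible ::
    "'a set \<Rightarrow> 'w measure \<Rightarrow> ('a \<Rightarrow> 'w measure) \<Rightarrow> (real \<Rightarrow> 'w \<Rightarrow> 'a) \<Rightarrow> ('a \<Rightarrow> real) \<Rightarrow> bool" where
  "reversible S \<Omega> P X \<mu> \<longleftrightarrow>
     (\<forall>T\<ge>0. \<forall>J x. finite J \<longrightarrow> J \<subseteq> {0..T} \<longrightarrow>
        prob_from S P \<mu> {\<omega>\<in>space \<Omega>. \<forall>s\<in>J. X s \<omega> = x s} =
        prob_from S P \<mu> {\<omega>\<in>space \<Omega>. \<forall>s\<in>J. X (T - s) \<omega> = x s})"


section \<open>The network\<close>

text \<open>
  The sites are the elements of the finite type \<open>'s\<close>. A configuration \<open>y\<close> of zeros and ones is
  represented by the set of sites at which it is 1, so that \<open>y\<close> changed by moving a distinguished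
  customer from \<open>j\<close> to \<open>j'\<close> is \<open>insert j' (y - {j})\<close>.
\<close>

type_synonym 's state = "'s set \<times> ('s \<Rightarrow> nat)"

definition states :: "nat \<Rightarrow> 's::finite state set" where
  "states N = {(y, n). (\<Sum>s\<in>UNIV. n s) = N}"

definition gamma_bar :: "('s \<Rightarrow> nat \<Rightarrow> real) \<Rightarrow> 's \<Rightarrow> nat \<Rightarrow> real" where
  "gamma_bar \<gamma> i n = (\<Prod>m<n. \<gamma> i m)"

text \<open>Only used for \<open>i \<noteq> k\<close> and \<open>n i \<ge> 1\<close>, so that the subtraction does not truncate.\<close>

definition move :: "'s \<Rightarrow> 's \<Rightarrow> ('s \<Rightarrow> nat) \<Rightarrow> 's \<Rightarrow> nat" where
  "move i k n = n(i := n i - 1, k := n k + 1)"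

text \<open>
  For given source and target at most one summand below is nonzero, as the different kinds of
  transitions and the different choices of sites all lead to different targets.
\<close>

fun jump_rate ::
    "('s::finite \<Rightarrow> nat \<Rightarrow> real) \<Rightarrow> ('s \<Rightarrow> real) \<Rightarrow> ('s \<Rightarrow> real) \<Rightarrow>
     ('s \<Rightarrow> 's \<Rightarrow> nat \<Rightarrow> nat \<Rightarrow> 's set \<Rightarrow> real) \<Rightarrow>
     ('s \<Rightarrow> 's \<Rightarrow> nat \<Rightarrow> nat \<Rightarrow> 's set \<Rightarrow> real) \<Rightarrow>
     ('s \<Rightarrow> 's \<Rightarrow> nat \<Rightarrow> nat \<Rightarrow> 's set \<Rightarrow> real) \<Rightarrow>
     ('s \<Rightarrow> 's \<Rightarrow> ('s \<Rightarrow> nat) \<Rightarrow> 's set \<Rightarrow> real) \<Rightarrow>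
     's state \<Rightarrow> 's state \<Rightarrow> real"
where
  "jump_rate \<gamma> \<xi> \<eta> \<beta> \<theta> \<epsilon> \<tau> (y, n) (y', n') =
     (\<Sum>k\<in>-y. \<Sum>l\<in>-y - {k}.
        \<beta> k l (n k) (n l) y * of_bool (n k \<ge> 1 \<and> y' = y \<and> n' = move k l n)) +
     (\<Sum>i\<in>y. \<Sum>j\<in>y - {i}.
        \<epsilon> i j (n i) (n j) y * of_bool (n i \<ge> 1 \<and> y' = y \<and> n' = move i j n)) +
     (\<Sum>j\<in>y. \<Sum>l\<in>-y.
        \<theta> j l (n j) (n l) y * of_bool (n j \<ge> 1 \<and> y' = y \<and> n' = move j l n)) +
     (\<Sum>j\<in>y. \<Sum>k\<in>-y.
        \<theta> k j (n k) (n j) y * \<gamma> j (n j) * of_bool (n k \<ge> 1 \<and> y' = y \<and> n' = move k j n)) +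
     (\<Sum>j\<in>y. \<Sum>j'\<in>-y.
        inverse (gamma_bar \<gamma> j (n j)) * \<tau> j j' n y * of_bool (y' = insert j' (y - {j}) \<and> n' = n)) +
     (\<Sum>k\<in>-y. \<xi> k * gamma_bar \<gamma> k (n k) * of_bool (y' = insert k y \<and> n' = n)) +
     (\<Sum>i\<in>y. \<eta> i * of_bool (y' = y - {i} \<and> n' = n))"

fun weight ::
    "('s::finite \<Rightarrow> nat \<Rightarrow> real) \<Rightarrow> ('s \<Rightarrow> real) \<Rightarrow> ('s \<Rightarrow> real) \<Rightarrow> 's state \<Rightarrow> real" where
  "weight \<gamma> \<xi> \<eta> (y, n) =
     (\<Prod>q\<in>UNIV. (\<xi> q / \<eta> q * gamma_bar \<gamma> q (n q)) ^ of_bool (q \<in> y))"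

definition partition_function ::
    "('s::finite \<Rightarrow> nat \<Rightarrow> real) \<Rightarrow> ('s \<Rightarrow> real) \<Rightarrow> ('s \<Rightarrow> real) \<Rightarrow> nat \<Rightarrow> real" where
  "partition_function \<gamma> \<xi> \<eta> N = (\<Sum>\<^sub>\<infinity>x\<in>states N. weight \<gamma> \<xi> \<eta> x)"

definition equilibrium ::
    "('s::finite \<Rightarrow> nat \<Rightarrow> real) \<Rightarrow> ('s \<Rightarrow> real) \<Rightarrow> ('s \<Rightarrow> real) \<Rightarrow> nat \<Rightarrow> 's state \<Rightarrow> real" where
  "equilibrium \<gamma> \<xi> \<eta> N x =
     of_bool (x \<in> states N) / partition_function \<gamma> \<xi> \<eta> N * weight \<gamma> \<xi> \<eta> x"

end

theory Submission
  imports Defs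
begin

text \<open>
  The equilibrium is in detailed balance with the jump rates, move by move: the moves of tasks between
  two sites pair up with each other, as do the exchanges of distinguished customers, while arrivals
  pair with departures. Detailed balance passes to all powers of the generator and hence to the
  transition function, which makes the process reversible.

  The process is irreducible, because every state leads, through departures of the distinguished
  customers followed by moves of tasks, to the one in which all tasks are at one fixed site, and
  detailed balance turns the edges around. So all transition probabilities over a positive time are
  positive. The density of a stationary distribution with respect to the equilibrium is then harmonic,
  hence constant by the maximum principle. Also, at integer times the process leaves and re-enters a
  given state within two steps with a probability bounded below, so return times have geometric tails.
\<close>

section \<open>Markov processes on a finite state space\<close>

text \<open>\<open>matrix_power\<close> is defined by multiplication from the left. Reversal turns
  the first factor of a product into the last, so the recursion from the right is required as
  well.\<close>

lemma matrix_power_Suc_right: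
  assumes "finite S" "x \<in> S" "z \<in> S"
  shows "matrix_power S Q (Suc k) x z = (\<Sum>w\<in>S. matrix_power S Q k x w * Q w z)"
  using assms(2)
proof (induction k arbitrary: x)
  case 0
  have "(\<Sum>w\<in>S. Q x w * of_bool (w = z)) = Q x z"
    using assms by (simp add: of_bool_def if_distrib cong: if_cong)
  moreover have "(\<Sum>w\<in>S. of_bool (x = w) * Q w z) = Q x z"
    using assms 0 by (simp add: of_bool_def if_distribR if_distrib cong: if_cong)
  ultimately show ?case by simp
next
  case (Suc k)
  have "matrix_power S Q (Suc (Suc k)) x z
      = (\<Sum>w\<in>S. Q x w * (\<Sum>v\<in>S. matrix_power S Q k w v * Q v z))"
    using Suc.IH by (subst matrix_power.simps) (auto intro!: sum.cong)
  also have "\<dots> = (\<Sum>v\<in>S. \<Sum>w\<in>S. Q x w * matrix_power S Q k w v * Q v z)"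
    by (subst sum.swap) (simp add: sum_distrib_left mult.assoc)
  also have "\<dots> = (\<Sum>v\<in>S. matrix_power S Q (Suc k) x v * Q v z)"
    by (simp add: sum_distrib_right)
  finally show ?case .
qed

text \<open>The sum of all absolute entries dominates every absolute row sum, so each factor of the
  product costs at most this constant. The exponential series then has a summable majorant.\<close>

lemma matrix_power_bound:
  assumes "finite S" "x \<in> S"
  shows "\<bar>matrix_power S Q k x z\<bar> \<le> (\<Sum>v\<in>S. \<Sum>w\<in>S. \<bar>Q v w\<bar>) ^ k"
  using assms(2)
proof (induction k arbitrary: x)
  case (Suc k)
  let ?C = "\<Sum>v\<in>S. \<Sum>w\<in>S. \<bar>Q v w\<bar>"
  have "\<bar>matrix_power S Q (Suc k) x z\<bar> \<le> (\<Sum>w\<in>S. \<bar>Q x w\<bar> * \<bar>matrix_power S Q k w z\<bar>)"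
    by (auto simp: abs_mult intro: order_trans[OF sum_abs])
  also have "\<dots> \<le> (\<Sum>w\<in>S. \<bar>Q x w\<bar> * ?C ^ k)"
    using Suc.IH by (intro sum_mono mult_left_mono) auto
  also have "\<dots> = (\<Sum>w\<in>S. \<bar>Q x w\<bar>) * ?C ^ k"
    by (simp add: sum_distrib_right)
  also have "\<dots> \<le> ?C * ?C ^ k"
    using assms(1) Suc.prems
    by (intro mult_right_mono member_le_sum[where f = "\<lambda>v. \<Sum>w\<in>S. \<bar>Q v w\<bar>"] zero_le_power sum_nonneg) auto
  finally show ?case by simp
qed simp

lemma transition_summable:
  assumes "finite S" "x \<in> S"
  shows "summable (\<lambda>k. t ^ k / fact k * matrix_power S Q k x z)"
proof (rule summable_comparison_test)
  let ?C = "\<Sum>v\<in>S. \<Sum>w\<in>S. \<bar>Q v w\<bar>"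
  show "\<exists>K. \<forall>k\<ge>K. norm (t ^ k / fact k * matrix_power S Q k x z) \<le> (\<bar>t\<bar> * ?C) ^ k /\<^sub>R fact k"
    using matrix_power_bound[OF assms, of Q _ z]
    by (auto simp: abs_mult power_abs power_mult_distrib field_simps intro!: divide_right_mono mult_left_mono)
  show "summable (\<lambda>k. (\<bar>t\<bar> * ?C) ^ k /\<^sub>R fact k)"
    by (rule summable_exp_generic)
qed

text \<open>The transition function is an everywhere convergent power series in \<open>t\<close>, so
  its derivative at 0 is the coefficient of the linear term, which is the entry of the first power
  of \<open>Q\<close>.\<close>

lemma transition_has_derivative_0:
  assumes "finite S" "x \<in> S" "z \<in> S"
  shows "((\<lambda>t. transition S Q t x z) has_real_derivative Q x z) (at 0)"
proof -
  let ?c = "\<lambda>k. matrix_power S Q k x z / fact k"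
  have eq: "transition S Q t x z = (\<Sum>k. ?c k * t ^ k)" for t
    unfolding transition_def by (simp add: mult.commute)
  have "summable (\<lambda>k. ?c k * t ^ k)" for t
    using transition_summable[OF assms(1,2), of t Q z] by (simp add: mult.commute)
  then have "((\<lambda>t. \<Sum>k. ?c k * t ^ k) has_field_derivative (\<Sum>k. diffs ?c k * 0 ^ k)) (at 0)"
    by (rule termdiffs_strong_converges_everywhere)
  moreover have "(\<Sum>k. diffs ?c k * 0 ^ k) = diffs ?c 0"
    by (rule powser_zero)
  moreover have "diffs ?c 0 = Q x z"
    using assms(1,3) by (simp add: diffs_def of_bool_def if_distrib cong: if_cong)
  ultimately show ?thesis unfolding eq by simp
qed

lemma transition_0: "transition S Q 0 x z = of_bool (x = z)"
  using powser_zero[of "\<lambda>k. matrix_power S Q k x z / fact k"]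
  by (simp add: transition_def mult.commute)

section \<open>Detailed balance for the transition function\<close>

text \<open>Balance carries the weight across the first factor from \<open>x\<close> to the
  intermediate state \<open>w\<close>, and the induction hypothesis carries it on from
  \<open>w\<close> to \<open>z\<close>. What remains is the product from \<open>z\<close> to
  \<open>x\<close> with its last factor split off.\<close>

lemma matrix_power_detailed_balance:
  assumes "finite S"
    and bal: "\<And>x z. x \<in> S \<Longrightarrow> z \<in> S \<Longrightarrow> \<mu> x * Q x z = \<mu> z * Q z x"
    and "x \<in> S" "z \<in> S"
  shows "\<mu> x * matrix_power S Q k x z = \<mu> z * matrix_power S Q k z x"
  using assms(3,4)
proof (induction k arbitrary: x)
  case (Suc k)
  have "\<mu> x * matrix_power S Q (Suc k) x z = (\<Sum>w\<in>S. \<mu> x * Q x w * matrix_power S Q k w z)"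
    by (simp add: sum_distrib_left mult.assoc)
  also have "\<dots> = (\<Sum>w\<in>S. Q w x * (\<mu> w * matrix_power S Q k w z))"
    using Suc.prems bal by (intro sum.cong) (auto simp: mult_ac)
  also have "\<dots> = (\<Sum>w\<in>S. Q w x * (\<mu> z * matrix_power S Q k z w))"
    using Suc by (intro sum.cong) auto
  also have "\<dots> = \<mu> z * matrix_power S Q (Suc k) z x"
    using matrix_power_Suc_right[OF assms(1) Suc.prems(2,1)]
    by (simp only: sum_distrib_left mult_ac)
  finally show ?case .
qed auto

lemma transition_detailed_balance:
  assumes "finite S"
    and "\<And>x z. x \<in> S \<Longrightarrow> z \<in> S \<Longrightarrow> \<mu> x * Q x z = \<mu> z * Q z x"
    and "x \<in> S" "z \<in> S"
  shows "\<mu> x * transition S Q t x z = \<mu> z * transition S Q t z x"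
proof -
  have "\<mu> x * (t ^ k / fact k * matrix_power S Q k x z)
      = \<mu> z * (t ^ k / fact k * matrix_power S Q k z x)" for k
    using matrix_power_detailed_balance[of S \<mu> Q x z k, OF assms]
    by (metis mult.left_commute)
  then show ?thesis
    unfolding transition_def using assms(1,3,4)
    by (simp only: transition_summable flip: suminf_mult)
qed

text \<open>\<open>path_probability\<close> is recursive at the front of the list; conditioning on
  the past and time reversal need the last step instead.\<close>

lemma path_probability_append:
  "path_probability S Q (ps @ [(s, v), (t, z)]) r x
     = path_probability S Q (ps @ [(s, v)]) r x * transition S Q (t - s) v z"
  by (induction ps arbitrary: r x) auto

section \<open>Events of the process and their probabilities\<close>

locale finite_markov_process =
  fixes S :: "'a set" and Q :: "'a \<Rightarrow> 'a \<Rightarrow> real"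
    and \<Omega> :: "'w measure" and P :: "'a \<Rightarrow> 'w measure" and X :: "real \<Rightarrow> 'w \<Rightarrow> 'a"
  assumes markov: "markov_process S Q \<Omega> P X"
begin

abbreviation "p \<equiv> transition S Q"

definition visits :: "(real \<times> 'a) list \<Rightarrow> 'w set" where
  "visits ps = {\<omega>\<in>space \<Omega>. \<forall>(t, z)\<in>set ps. X t \<omega> = z}"

lemma finite_S: "finite S"
  using markov by (simp add: markov_process_def)

lemma prob_space_P: "x \<in> S \<Longrightarrow> prob_space (P x)"
  and sets_P: "x \<in> S \<Longrightarrow> sets (P x) = sets \<Omega>"
  and X_measurable: "0 \<le> t \<Longrightarrow> X t \<in> measurable \<Omega> (count_space S)"
  using markov by (simp_all add: markov_process_def)

lemma space_P: "x \<in> S \<Longrightarrow> space (P x) = space \<Omega>"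
  using sets_P sets_eq_imp_space_eq by blast

lemma X_in_S: "0 \<le> t \<Longrightarrow> \<omega> \<in> space \<Omega> \<Longrightarrow> X t \<omega> \<in> S"
  using X_measurable[of t] by (auto dest: measurable_space)

lemma sets_X_eq:
  assumes "0 \<le> t" shows "{\<omega>\<in>space \<Omega>. X t \<omega> = z} \<in> sets \<Omega>"
proof (cases "z \<in> S")
  case True
  then have "X t -` {z} \<inter> space \<Omega> \<in> sets \<Omega>"
    using X_measurable[OF assms] by (intro measurable_sets[of _ _ "count_space S"]) auto
  then show ?thesis by (simp add: vimage_def Int_def conj_commute)
next
  case False
  then have "{\<omega>\<in>space \<Omega>. X t \<omega> = z} = {}" using X_in_S[OF assms] by auto
  then show ?thesis by (simp only: sets.empty_sets)
qed

lemma sets_visits: "\<forall>(t, z)\<in>set ps. 0 \<le> t \<Longrightarrow> visits ps \<in> sets \<Omega>"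
proof -
  assume "\<forall>(t, z)\<in>set ps. 0 \<le> t"
  then have "{\<omega>\<in>space \<Omega>. \<forall>p\<in>set ps. X (fst p) \<omega> = snd p} \<in> sets \<Omega>"
    by (intro sets.sets_Collect_finite_All) (auto intro!: sets_X_eq)
  then show ?thesis by (simp add: visits_def case_prod_unfold)
qed

lemma measure_visits:
  assumes "x \<in> S" "sorted (map fst ps)" "\<forall>(t, z)\<in>set ps. 0 \<le> t \<and> z \<in> S"
  shows "measure (P x) (visits ps) = path_probability S Q ps 0 x"
  using markov assms by (simp add: markov_process_def visits_def)

text \<open>Reading the exponential series as a probability yields nonnegativity, row sums and the
  semigroup property from measure theory, without any computation with matrix exponentials.\<close>

lemma transition_eq_measure:
  assumes "x \<in> S" "z \<in> S" "0 \<le> t"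
  shows "p t x z = measure (P x) (visits [(t, z)])"
  using assms by (simp add: measure_visits)

lemma transition_nonneg: "x \<in> S \<Longrightarrow> z \<in> S \<Longrightarrow> 0 \<le> t \<Longrightarrow> 0 \<le> p t x z"
  by (simp add: transition_eq_measure)

lemma measure_split:
  assumes "x \<in> S" "0 \<le> t" "A \<in> sets \<Omega>"
  shows "measure (P x) A = (\<Sum>z\<in>S. measure (P x) {\<omega>\<in>A. X t \<omega> = z})"
proof -
  interpret prob_space "P x" using assms prob_space_P by simp
  have A: "A \<subseteq> space \<Omega>" using assms(3) by (rule sets.sets_into_space)
  then have "A = (\<Union>z\<in>S. {\<omega>\<in>A. X t \<omega> = z})"
    using X_in_S[OF assms(2)] by auto
  moreover have "{\<omega>\<in>A. X t \<omega> = z} \<in> sets \<Omega>" for z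
  proof -
    have "A \<inter> {\<omega>\<in>space \<Omega>. X t \<omega> = z} \<in> sets \<Omega>"
      using assms by (intro sets.Int sets_X_eq)
    also have "A \<inter> {\<omega>\<in>space \<Omega>. X t \<omega> = z} = {\<omega>\<in>A. X t \<omega> = z}" using A by auto
    finally show ?thesis .
  qed
  ultimately show ?thesis
    using finite_measure_finite_Union[of S "\<lambda>z. {\<omega>\<in>A. X t \<omega> = z}"] finite_S sets_P[OF assms(1)]
    by (auto simp: disjoint_family_on_def)
qed

lemma transition_sum:
  assumes "x \<in> S" "0 \<le> t"
  shows "(\<Sum>z\<in>S. p t x z) = 1"
proof -
  have "1 = measure (P x) (space \<Omega>)"
    using prob_space.prob_space[OF prob_space_P[OF assms(1)]] space_P[OF assms(1)] by simp
  also have "\<dots> = (\<Sum>z\<in>S. p t x z)"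
    using assms
    by (subst measure_split[OF assms]) (auto simp: transition_eq_measure visits_def intro!: sum.cong)
  finally show ?thesis by simp
qed

section \<open>Semigroup property and positivity of transition probabilities\<close>

text \<open>The event of being in \<open>z\<close> at time \<open>s + t\<close> is split according
  to the state at time \<open>s\<close>.\<close>

lemma chapman_kolmogorov:
  assumes "x \<in> S" "z \<in> S" "0 \<le> s" "0 \<le> t"
  shows "p (s + t) x z = (\<Sum>w\<in>S. p s x w * p t w z)"
proof -
  have "p (s + t) x z = measure (P x) (visits [(s + t, z)])"
    using assms by (simp add: transition_eq_measure)
  also have "\<dots> = (\<Sum>w\<in>S. measure (P x) (visits [(s, w), (s + t, z)]))"
    using assms
    by (subst measure_split[of _ s])
      (auto intro!: sets_visits sets_X_eq sum.cong arg_cong[where f = "measure (P x)"] simp: visits_def)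
  also have "\<dots> = (\<Sum>w\<in>S. p s x w * p t w z)"
    using assms by (intro sum.cong) (auto simp: measure_visits)
  finally show ?thesis .
qed

lemma chapman_kolmogorov_ge:
  assumes "x \<in> S" "w \<in> S" "z \<in> S" "0 \<le> s" "0 \<le> t"
  shows "p s x w * p t w z \<le> p (s + t) x z"
  unfolding chapman_kolmogorov[OF assms(1,3,4,5)]
  using assms finite_S by (intro member_le_sum) (auto intro: mult_nonneg_nonneg transition_nonneg)

text \<open>At time 0 the value is 1, so by continuity it is positive at all times below some
  \<open>d\<close>. A general \<open>t\<close> is cut into \<open>n\<close> equal pieces shorter
  than \<open>d\<close>, and the process may be in \<open>x\<close> at the end of each.\<close>

lemma transition_diag_pos:
  assumes "x \<in> S" "0 \<le> t"
  shows "0 < p t x x"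
proof -
  have "((\<lambda>t. p t x x) \<longlongrightarrow> p 0 x x) (at 0)"
    using DERIV_isCont[OF transition_has_derivative_0[OF finite_S assms(1,1)]]
    by (simp add: isCont_def)
  then have "\<forall>\<^sub>F t in at 0. 0 < p t x x"
    by (rule order_tendstoD) (simp add: transition_0)
  then obtain d where d: "d > 0" "\<And>s. s \<noteq> 0 \<Longrightarrow> \<bar>s\<bar> < d \<Longrightarrow> 0 < p s x x"
    by (auto simp: eventually_at dist_real_def)
  obtain n :: nat where "t < real n * d"
    using reals_Archimedean3[OF d(1)] by blast
  moreover from this have "n \<noteq> 0" using assms(2) by (intro notI) simp
  ultimately have n: "n \<noteq> 0" "t / n < d" by (simp_all add: pos_divide_less_eq mult.commute)
  then have "0 < p (t / n) x x"
    using d(2)[of "t / n"] assms(2) by (cases "t = 0") (auto simp: transition_0)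
  then have *: "0 < p (real k * (t / n)) x x" for k
  proof (induction k)
    case (Suc k)
    have "0 < p (t / n) x x * p (real k * (t / n)) x x" using Suc by simp
    also have "\<dots> \<le> p (t / n + real k * (t / n)) x x"
      using assms by (intro chapman_kolmogorov_ge) auto
    finally show ?case by (simp add: algebra_simps add_divide_distrib)
  qed (simp add: transition_0)
  show ?thesis using *[of n] n by simp
qed

text \<open>Along a path of positive rates, the last edge is crossed in a short final time
  \<open>h\<close>, where the positive derivative at 0 makes the transition probability positive;
  the time \<open>t - h\<close> is left for the edges before.\<close>

lemma transition_pos:
  assumes "(x, z) \<in> {(a, b). a \<in> S \<and> b \<in> S \<and> Q a b > 0}\<^sup>*" "x \<in> S" "0 < t"
  shows "0 < p t x z"
proof -
  have "z \<in> S \<and> (\<forall>t>0. 0 < p t x z)"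
    using assms(1)
  proof (induction rule: rtrancl_induct)
    case base
    then show ?case using assms(2) transition_diag_pos by simp
  next
    case (step w z)
    then have wz: "w \<in> S" "z \<in> S" "Q w z > 0" by auto
    obtain d where d: "d > 0" "\<And>h. 0 < h \<Longrightarrow> h < d \<Longrightarrow> p 0 w z < p h w z"
      using has_real_derivative_pos_inc_right
        [of "\<lambda>t. p t w z", OF transition_has_derivative_0[OF finite_S wz(1,2)] wz(3)] by auto
    have "0 < p t x z" if "t > 0" for t
    proof -
      define h where "h = min d t / 2"
      have h: "0 < h" "h < d" "h < t" using d(1) that by (auto simp: h_def)
      \<comment> \<open>The value at time 0 is only bounded from below, as \<open>w = z\<close> is
        not excluded here.\<close>
      have "0 \<le> p 0 w z" by (simp add: transition_0)
      then have "0 < p h w z" using d(2)[OF h(1,2)] by linarith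
      moreover have "0 < p (t - h) x w" using step.IH h by auto
      ultimately have "0 < p (t - h) x w * p h w z" by simp
      also have "\<dots> \<le> p (t - h + h) x z"
        using h wz assms(2) by (intro chapman_kolmogorov_ge) auto
      finally show ?thesis by simp
    qed
    then show ?case using wz by blast
  qed
  then show ?thesis using assms(3) by blast
qed

section \<open>Geometric tails of return times\<close>

text \<open>
  The process is only observed at the times \<open>s + i * h\<close>, grouped in pairs. A visit to \<open>w \<noteq> x\<close>
  followed by one to \<open>x\<close> within a pair implies that \<open>x\<close> has been left and entered again.
\<close>

definition no_return :: "real \<Rightarrow> 'a \<Rightarrow> 'a \<Rightarrow> nat \<Rightarrow> real \<Rightarrow> 'w set" where
  "no_return h w x m s = {\<omega>\<in>space \<Omega>.
     \<forall>i<m. \<not> (X (s + (2 * real i + 1) * h) \<omega> = w \<and> X (s + (2 * real i + 2) * h) \<omega> = x)}"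

lemma sets_no_return:
  assumes "0 \<le> s" "0 \<le> h"
  shows "no_return h w x m s \<in> sets \<Omega>"
proof -
  have "{\<omega>\<in>space \<Omega>. \<forall>i\<in>{..<m}.
      \<not> (X (s + (2 * i + 1) * h) \<omega> = w \<and> X (s + (2 * i + 2) * h) \<omega> = x)} \<in> sets \<Omega>"
    using assms
    by (intro sets.sets_Collect_finite_All sets.sets_Collect_neg sets.sets_Collect_conj sets_X_eq) auto
  then show ?thesis unfolding no_return_def Ball_def lessThan_iff .
qed

lemma in_space_no_return: "\<omega> \<in> no_return h w x m s \<Longrightarrow> \<omega> \<in> space \<Omega>"
  by (simp add: no_return_def)

lemma no_return_Suc:
  "no_return h w x (Suc m) s =
     {\<omega>\<in>no_return h w x m (s + 2 * h). \<not> (X (s + h) \<omega> = w \<and> X (s + 2 * h) \<omega> = x)}"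
proof -
  \<comment> \<open>Raising the index of a pair by one amounts to starting the observation later by
    \<open>2 * h\<close>.\<close>
  have eq: "s + (2 * real (Suc i) + 1) * h = s + 2 * h + (2 * real i + 1) * h"
       "s + (2 * real (Suc i) + 2) * h = s + 2 * h + (2 * real i + 2) * h" for i
    by (simp_all add: algebra_simps)
  then show ?thesis
    unfolding no_return_def All_less_Suc2 eq by auto
qed

text \<open>Whatever the past, the next pair of observations is \<open>w\<close>, \<open>x\<close>
  with conditional probability at least \<open>c\<^sup>2\<close>. The history \<open>ps\<close> is
  arbitrary because in the induction the two new observations are appended to it.\<close>

lemma measure_no_return:
  assumes "x \<in> S" "w \<in> S" "x0 \<in> S" "0 < h" "0 \<le> c"
    and c: "\<And>a b. a \<in> S \<Longrightarrow> b \<in> S \<Longrightarrow> c \<le> p h a b"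
    and "sorted (map fst (ps @ [(s, v)]))" "\<forall>(t, z)\<in>set (ps @ [(s, v)]). 0 \<le> t \<and> z \<in> S"
  shows "measure (P x0) (visits (ps @ [(s, v)]) \<inter> no_return h w x m s)
     \<le> (1 - c\<^sup>2) ^ m * measure (P x0) (visits (ps @ [(s, v)]))"
  using assms(7,8)
proof (induction m arbitrary: ps s v)
  case 0
  have "visits (ps @ [(s, v)]) \<inter> no_return h w x 0 s = visits (ps @ [(s, v)])"
    by (auto simp: no_return_def visits_def)
  then show ?case by simp
next
  case (Suc m)
  interpret prob_space "P x0" using assms prob_space_P by simp
  note sets_P0 = sets_P[OF assms(3)]
  let ?ps = "ps @ [(s, v)]"
  let ?V = "visits ?ps"
  let ?W = "\<lambda>a b. visits ((?ps @ [(s + h, a)]) @ [(s + 2 * h, b)])"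
  let ?F = "no_return h w x m (s + 2 * h)"
  let ?M = "measure (P x0)"
  have s: "0 \<le> s" "v \<in> S" using Suc.prems by auto
  have sorted': "sorted (map fst ((?ps @ [(s + h, a)]) @ [(s + 2 * h, b)]))" for a b
    using Suc.prems(1) assms(4) by (auto simp: sorted_append)
  have S': "\<forall>(t, z)\<in>set ((?ps @ [(s + h, a)]) @ [(s + 2 * h, b)]). 0 \<le> t \<and> z \<in> S"
    if "a \<in> S" "b \<in> S" for a b
    using Suc.prems(2) assms(4) that by auto
  have sets_V: "?V \<in> sets \<Omega>" using Suc.prems by (intro sets_visits) auto
  have sets_F: "?F \<in> sets \<Omega>" and sets_F': "no_return h w x (Suc m) s \<in> sets \<Omega>"
    using s assms by (auto intro!: sets_no_return)
  \<comment> \<open>Every event is split according to the states at the two times of the first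
    pair.\<close>
  have cube: "?M A = (\<Sum>a\<in>S. \<Sum>b\<in>S. ?M {\<omega>\<in>A. X (s + h) \<omega> = a \<and> X (s + 2 * h) \<omega> = b})"
    if "A \<in> sets \<Omega>" for A
  proof -
    have "{\<omega>\<in>A. X (s + h) \<omega> = a} \<in> sets \<Omega>" for a
    proof -
      have "A \<inter> {\<omega>\<in>space \<Omega>. X (s + h) \<omega> = a} \<in> sets \<Omega>"
        using that s assms(4) by (intro sets.Int sets_X_eq) auto
      also have "A \<inter> {\<omega>\<in>space \<Omega>. X (s + h) \<omega> = a} = {\<omega>\<in>A. X (s + h) \<omega> = a}"
        using sets.sets_into_space[OF that] by auto
      finally show ?thesis .
    qed
    then have "?M {\<omega>\<in>A. X (s + h) \<omega> = a}
        = (\<Sum>b\<in>S. ?M {\<omega>\<in>A. X (s + h) \<omega> = a \<and> X (s + 2 * h) \<omega> = b})" for a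
      using s assms(4) by (subst measure_split[OF assms(3), of "s + 2 * h"]) (auto simp: conj_assoc)
    then show ?thesis
      using s assms(4) by (subst measure_split[OF assms(3) _ that, of "s + h"]) auto
  qed
  have sum_W: "?M ?V = (\<Sum>a\<in>S. \<Sum>b\<in>S. ?M (?W a b))"
    by (subst cube[OF sets_V])
      (auto simp: visits_def intro!: sum.cong arg_cong[where f = ?M])
  \<comment> \<open>The first pair excludes exactly the summand \<open>a = w\<close>,
    \<open>b = x\<close>; in the others the remaining \<open>m\<close> pairs form an event of the
    same kind started at \<open>s + 2 * h\<close>.\<close>
  have "?M (?V \<inter> no_return h w x (Suc m) s)
      = (\<Sum>a\<in>S. \<Sum>b\<in>S. of_bool (\<not> (a = w \<and> b = x)) * ?M (?W a b \<inter> ?F))"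
  proof (subst cube[OF sets.Int[OF sets_V sets_F']], intro sum.cong refl, goal_cases)
    case (1 a b)
    have "{\<omega> \<in> ?V \<inter> no_return h w x (Suc m) s. X (s + h) \<omega> = a \<and> X (s + 2 * h) \<omega> = b}
       = (if a = w \<and> b = x then {} else ?W a b \<inter> ?F)"
      unfolding no_return_Suc by (auto simp: visits_def)
    then show ?case by simp
  qed
  also have "\<dots> \<le> (\<Sum>a\<in>S. \<Sum>b\<in>S. of_bool (\<not> (a = w \<and> b = x)) * ((1 - c\<^sup>2) ^ m * ?M (?W a b)))"
    by (intro sum_mono mult_left_mono Suc.IH sorted' S') auto
  also have "\<dots> = (1 - c\<^sup>2) ^ m
      * (\<Sum>a\<in>S. \<Sum>b\<in>S. ?M (?W a b) - (if a = w then if b = x then ?M (?W a b) else 0 else 0))"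
    unfolding sum_distrib_left by (intro sum.cong) auto
  also have "\<dots> = (1 - c\<^sup>2) ^ m * (?M ?V - ?M (?W w x))"
  proof -
    have "(\<Sum>b\<in>S. if a = w then if b = x then ?M (?W a b) else 0 else 0)
        = (if a = w then ?M (?W w x) else 0)" for a
      using finite_S assms(1) by (cases "a = w") auto
    then show ?thesis
      unfolding sum_subtractf sum_W[symmetric] using finite_S assms(2) by simp
  qed
  also have "\<dots> \<le> (1 - c\<^sup>2) ^ m * (?M ?V - c\<^sup>2 * ?M ?V)"
  proof -
    have "?M (?W w x) = path_probability S Q ((ps @ [(s, v), (s + h, w)]) @ [(s + 2 * h, x)]) 0 x0"
      using measure_visits[OF assms(3) sorted' S'[OF assms(2,1)]] by simp
    also have "\<dots> = path_probability S Q ?ps 0 x0 * p h v w * p h w x"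
      using path_probability_append[of S Q "ps @ [(s, v)]" "s + h" w "s + 2 * h" x 0 x0]
        path_probability_append[of S Q ps s v "s + h" w 0 x0] by simp
    also have "path_probability S Q ?ps 0 x0 = ?M ?V"
      using Suc.prems measure_visits[OF assms(3)] by metis
    finally have eq: "?M (?W w x) = ?M ?V * (p h v w * p h w x)" by simp
    have "c * c \<le> p h v w * p h w x"
      using c[OF s(2) assms(2)] c[OF assms(2,1)] assms(5) by (intro mult_mono) auto
    then have "?M ?V * (c * c) \<le> ?M ?V * (p h v w * p h w x)"
      by (rule mult_left_mono) simp
    then have "c\<^sup>2 * ?M ?V \<le> ?M (?W w x)"
      unfolding eq power2_eq_square by (simp only: mult_ac)
    \<comment> \<open>This makes the factor \<open>(1 - c\<^sup>2) ^ m\<close> nonnegative, so that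
      it preserves the inequality.\<close>
    moreover have "c \<le> 1"
    proof -
      have "p h w x \<le> (\<Sum>z\<in>S. p h w z)"
        using assms finite_S by (intro member_le_sum) (auto intro: transition_nonneg)
      then show ?thesis using c[OF assms(2,1)] transition_sum[OF assms(2), of h] assms(4) by simp
    qed
    ultimately show ?thesis
      using assms(5) by (intro mult_left_mono) (auto simp: power_le_one)
  qed
  also have "\<dots> = (1 - c\<^sup>2) ^ Suc m * ?M ?V" by (simp add: algebra_simps)
  finally show ?case .
qed

text \<open>The series counts \<open>2 * h\<close> for each \<open>m\<close> for which no return is
  seen in the first \<open>m\<close> pairs. If a return is first seen within \<open>k\<close> pairs,
  it happens by time \<open>2 * h * k\<close>, the sum of the terms below \<open>k\<close>; if none
  is ever seen, the series is infinite.\<close>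

lemma return_time_le_suminf:
  assumes "\<omega> \<in> space \<Omega>" "w \<noteq> x" "0 < h"
  shows "return_time X x \<omega> \<le> (\<Sum>m. ennreal (2 * h) * indicator (no_return h w x m 0) \<omega>)"
proof (cases "\<forall>m. \<omega> \<in> no_return h w x m 0")
  case True
  have "ennreal (2 * h) * of_nat n \<le> (\<Sum>m. ennreal (2 * h) * indicator (no_return h w x m 0) \<omega>)" for n
    using True sum_le_suminf[of "\<lambda>m. ennreal (2 * h) * indicator (no_return h w x m 0) \<omega>" "{..<n}"]
    by (simp add: mult.commute)
  then have "(SUP n. ennreal (2 * h) * of_nat n)
      \<le> (\<Sum>m. ennreal (2 * h) * indicator (no_return h w x m 0) \<omega>)"
    by (intro SUP_least)
  moreover have "(SUP n. ennreal (2 * h) * of_nat n) = top"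
    using assms(3) by (simp add: SUP_mult_left_ennreal[symmetric] ennreal_SUP_of_nat_eq_top ennreal_mult_top)
  ultimately show ?thesis by (simp add: top_unique)
next
  case False
  define k where "k = (LEAST m. \<omega> \<notin> no_return h w x m 0)"
  have k: "\<omega> \<notin> no_return h w x k 0"
    using False LeastI_ex[of "\<lambda>m. \<omega> \<notin> no_return h w x m 0"] unfolding k_def by simp
  have below: "\<omega> \<in> no_return h w x m 0" if "m < k" for m
    using not_less_Least[of m "\<lambda>m. \<omega> \<notin> no_return h w x m 0"] that unfolding k_def by blast
  obtain i where i: "i < k" "X ((2 * i + 1) * h) \<omega> = w" "X ((2 * i + 2) * h) \<omega> = x"
    using k assms(1) by (auto simp: no_return_def)
  define t where "t = (2 * real i + 2) * h"
  have t: "0 \<le> t" "X t \<omega> = x" "(2 * real i + 1) * h \<in> {0..t}"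
    using i(3) assms(3) by (auto simp: t_def mult_right_mono)
  then have "return_time X x \<omega> \<le> ennreal t"
    unfolding return_time_def using i(2) assms(2) by (intro INF_lower) blast
  also have "t \<le> 2 * h * k"
  proof -
    have "2 * real i + 2 \<le> 2 * real k" using i(1) by linarith
    then have "(2 * real i + 2) * h \<le> 2 * real k * h" using assms(3) by (intro mult_right_mono) auto
    then show ?thesis by (simp only: t_def mult_ac)
  qed
  then have "ennreal t \<le> ennreal (2 * h * k)" by (rule ennreal_leI)
  also have "\<dots> = (\<Sum>m<k. ennreal (2 * h) * indicator (no_return h w x m 0) \<omega>)"
    using below assms(3) by (simp add: ennreal_mult ennreal_of_nat_eq_real_of_nat mult.commute)
  also have "\<dots> \<le> (\<Sum>m. ennreal (2 * h) * indicator (no_return h w x m 0) \<omega>)"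
    by (intro sum_le_suminf) auto
  finally show ?thesis .
qed

text \<open>With \<open>c\<close> the least entry of the kernel at time \<open>h\<close>, the terms
  of the bounding series have expectations dominated by a geometric sequence of ratio
  \<open>1 - c\<^sup>2\<close>.\<close>

lemma return_time_integral_finite:
  assumes "x \<in> S" "w \<in> S" "w \<noteq> x" "x0 \<in> S" "0 < h"
    and pos: "\<And>a b. a \<in> S \<Longrightarrow> b \<in> S \<Longrightarrow> 0 < p h a b"
  shows "(\<integral>\<^sup>+ \<omega>. return_time X x \<omega> \<partial>P x0) < \<infinity>"
proof -
  interpret prob_space "P x0" using assms prob_space_P by simp
  define c where "c = Min ((\<lambda>(a, b). p h a b) ` (S \<times> S))"
  have fin: "finite ((\<lambda>(a, b). p h a b) ` (S \<times> S))" "(\<lambda>(a, b). p h a b) ` (S \<times> S) \<noteq> {}"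
    using finite_S assms(1) by auto
  have c_le: "c \<le> p h a b" if "a \<in> S" "b \<in> S" for a b
    unfolding c_def using fin that by (intro Min_le) auto
  have c_pos: "0 < c" unfolding c_def using fin pos by (subst Min_gr_iff) auto
  \<comment> \<open>As \<open>w\<close> and \<open>x\<close> are distinct, two positive entries
    share one row of sum 1, which forces \<open>c < 1\<close>.\<close>
  have "p h x w + p h x x \<le> 1"
  proof -
    have "(\<Sum>z\<in>{w, x}. p h x z) \<le> (\<Sum>z\<in>S. p h x z)"
      using assms finite_S by (intro sum_mono2) (auto intro: transition_nonneg)
    then show ?thesis using assms transition_sum[of x h] by simp
  qed
  then have c_less: "c < 1" using c_le[OF assms(1,2)] pos[OF assms(1,1)] by linarith
  have bound: "measure (P x0) (no_return h w x m 0) \<le> (1 - c\<^sup>2) ^ m" for m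
  proof -
    \<comment> \<open>The state at time 0 serves as the history that the bound on
      \<open>no_return\<close> presupposes.\<close>
    have "measure (P x0) (no_return h w x m 0)
        = (\<Sum>v\<in>S. measure (P x0) (visits ([] @ [(0, v)]) \<inter> no_return h w x m 0))"
      using assms(4,5) by (subst measure_split[OF _ _ sets_no_return, of _ 0])
        (auto simp: visits_def intro!: sum.cong arg_cong[where f = "measure (P x0)"] dest: in_space_no_return)
    also have "\<dots> \<le> (\<Sum>v\<in>S. (1 - c\<^sup>2) ^ m * measure (P x0) (visits ([] @ [(0, v)])))"
      using assms c_pos c_le by (intro sum_mono measure_no_return) auto
    also have "\<dots> = (1 - c\<^sup>2) ^ m"
      using transition_sum[OF assms(4), of 0] assms(4)
      by (simp add: transition_eq_measure flip: sum_distrib_left)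
    finally show ?thesis .
  qed
  have "(\<integral>\<^sup>+ \<omega>. return_time X x \<omega> \<partial>P x0)
      \<le> (\<integral>\<^sup>+ \<omega>. (\<Sum>m. ennreal (2 * h) * indicator (no_return h w x m 0) \<omega>) \<partial>P x0)"
    using assms space_P by (intro nn_integral_mono return_time_le_suminf) auto
  also have "\<dots> = (\<Sum>m. ennreal (2 * h) * emeasure (P x0) (no_return h w x m 0))"
  proof -
    have "no_return h w x m 0 \<in> sets (P x0)" for m
      using assms(4,5) sets_no_return sets_P by simp
    then show ?thesis
      by (subst nn_integral_suminf)
        (auto intro!: borel_measurable_times_ennreal borel_measurable_indicator suminf_cong
          simp: nn_integral_cmult_indicator simp del: ennreal_suminf_cmult)
  qed
  also have "\<dots> \<le> (\<Sum>m. ennreal (2 * h * (1 - c\<^sup>2) ^ m))"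
    using assms bound by (intro suminf_le)
      (auto simp: emeasure_eq_measure ennreal_mult'[symmetric] intro!: ennreal_leI)
  also have "\<dots> < \<infinity>"
  proof -
    have c2: "0 < c\<^sup>2" "c\<^sup>2 < 1" using c_pos c_less by (auto simp: power_less_one_iff)
    then have "summable (\<lambda>m. 2 * h * (1 - c\<^sup>2) ^ m)"
      by (intro summable_mult summable_geometric) auto
    then show ?thesis
      using c2 assms(5) by (subst suminf_ennreal2) auto
  qed
  finally show ?thesis .
qed

lemma positive_recurrentI:
  assumes "\<And>x. x \<in> S \<Longrightarrow> \<exists>w\<in>S. w \<noteq> x"
    and "\<And>a b. a \<in> S \<Longrightarrow> b \<in> S \<Longrightarrow> 0 < p 1 a b"
  shows "positive_recurrent S Q P X"
  unfolding positive_recurrent_def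
proof (intro ballI disjI2)
  fix x assume x: "x \<in> S"
  then obtain w where "w \<in> S" "w \<noteq> x" using assms(1) by blast
  then show "(\<integral>\<^sup>+ \<omega>. return_time X x \<omega> \<partial>P x) < \<infinity>"
    using return_time_integral_finite[OF x _ _ x zero_less_one assms(2)] by blast
qed

end

section \<open>Reversibility and uniqueness of the stationary distribution\<close>

locale balanced_markov_process = finite_markov_process S Q \<Omega> P X
  for S :: "'a set" and Q and \<Omega> :: "'w measure" and P and X +
  fixes \<mu> :: "'a \<Rightarrow> real"
  assumes balance: "\<And>x z. x \<in> S \<Longrightarrow> z \<in> S \<Longrightarrow> \<mu> x * Q x z = \<mu> z * Q z x"
begin

lemma p_balance: "x \<in> S \<Longrightarrow> z \<in> S \<Longrightarrow> \<mu> x * p t x z = \<mu> z * p t z x"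
  by (rule transition_detailed_balance[OF finite_S balance])

lemma p_invariant:
  assumes "z \<in> S" "0 \<le> t"
  shows "(\<Sum>x\<in>S. \<mu> x * p t x z) = \<mu> z"
proof -
  have "(\<Sum>x\<in>S. \<mu> x * p t x z) = (\<Sum>x\<in>S. \<mu> z * p t z x)"
    using assms by (intro sum.cong p_balance) auto
  then show ?thesis using transition_sum[OF assms] by (simp flip: sum_distrib_left)
qed

text \<open>
  The probability of a path of the process started from \<open>\<mu>\<close>. By invariance the time of the first
  visit is irrelevant, which makes the expression symmetric under time reversal.
\<close>

definition path_weight :: "(real \<times> 'a) list \<Rightarrow> real" where
  "path_weight ps =
     (case ps of [] \<Rightarrow> \<Sum>x\<in>S. \<mu> x | (t, z) # qs \<Rightarrow> \<mu> z * path_probability S Q qs t z)"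

lemma path_weight_append:
  "path_weight (ps @ [(s, v), (t, z)]) = path_weight (ps @ [(s, v)]) * p (t - s) v z"
  by (cases ps) (auto simp: path_weight_def path_probability_append)

text \<open>Detailed balance carries the weight from the first visit to the second and turns the
  step between them around; the induction hypothesis reverses the rest. Reflecting the times at
  \<open>T\<close> leaves the lengths of the steps unchanged.\<close>

lemma path_weight_rev:
  assumes "\<forall>(t, z)\<in>set ps. z \<in> S"
  shows "path_weight (rev (map (\<lambda>(t, z). (T - t, z)) ps)) = path_weight ps"
  using assms
proof (induction ps rule: induct_list012)
  case (3 q r ps)
  obtain s v t z where [simp]: "q = (s, v)" "r = (t, z)" by fastforce
  have "path_weight (rev (map (\<lambda>(t, z). (T - t, z)) (q # r # ps)))
      = path_weight ((t, z) # ps) * p (t - s) z v"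
    using 3 path_weight_append[of "rev (map (\<lambda>(t, z). (T - t, z)) ps)" "T - t" z "T - s" v] by simp
  also have "\<dots> = path_weight (q # r # ps)"
    using p_balance[of v z "t - s"] "3.prems" by (simp add: path_weight_def)
  finally show ?case .
qed (auto simp: path_weight_def)

text \<open>The stretch from time 0 to the first observation is summed out by invariance of
  \<open>\<mu>\<close>.\<close>

lemma prob_from_visits:
  assumes "sorted (map fst ps)" "\<forall>(t, z)\<in>set ps. 0 \<le> t \<and> z \<in> S"
  shows "prob_from S P \<mu> (visits ps) = path_weight ps"
proof -
  have "prob_from S P \<mu> (visits ps) = (\<Sum>x\<in>S. \<mu> x * path_probability S Q ps 0 x)"
    using assms by (simp add: prob_from_def measure_visits)
  also have "\<dots> = path_weight ps"
  proof (cases ps)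
    case (Cons q qs)
    then show ?thesis
      using assms(2) p_invariant[of "snd q" "fst q"]
      by (auto simp: path_weight_def mult.assoc[symmetric] simp flip: sum_distrib_right split: prod.split)
  qed (simp add: path_weight_def)
  finally show ?thesis .
qed

lemma reversibleI: "reversible S \<Omega> P X \<mu>"
  unfolding reversible_def
proof (intro allI impI)
  fix T :: real and J :: "real set" and x :: "real \<Rightarrow> 'a"
  assume J: "finite J" "J \<subseteq> {0..T}"
  define ps where "ps = map (\<lambda>s. (s, x s)) (sorted_list_of_set J)"
  define qs where "qs = rev (map (\<lambda>(t, z). (T - t, z)) ps)"
  have ps: "{\<omega>\<in>space \<Omega>. \<forall>s\<in>J. X s \<omega> = x s} = visits ps"
    using J(1) by (auto simp: visits_def ps_def)
  have qs: "{\<omega>\<in>space \<Omega>. \<forall>s\<in>J. X (T - s) \<omega> = x s} = visits qs"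
    using J(1) by (auto simp: visits_def ps_def qs_def)
  have "prob_from S P \<mu> (visits ps) = prob_from S P \<mu> (visits qs)"
  proof (cases "\<forall>s\<in>J. x s \<in> S")
    case True
    have "map fst ps = sorted_list_of_set J" by (simp add: ps_def comp_def)
    then have "sorted (map fst ps)" by simp
    moreover have "map fst qs = rev (map (\<lambda>t. T - t) (sorted_list_of_set J))"
      by (simp add: ps_def qs_def comp_def rev_map)
    then have "sorted (map fst qs)"
      by (simp add: sorted_wrt_rev sorted_wrt_map)
    moreover have "\<forall>(t, z)\<in>set ps. 0 \<le> t \<and> z \<in> S" "\<forall>(t, z)\<in>set qs. 0 \<le> t \<and> z \<in> S"
      using J True by (auto simp: ps_def qs_def)
    moreover have "path_weight qs = path_weight ps"
      unfolding qs_def using True J(1) by (intro path_weight_rev) (auto simp: ps_def)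
    ultimately show ?thesis by (simp add: prob_from_visits)
  next
    case False
    \<comment> \<open>A prescribed value outside the state space makes both events empty.\<close>
    then obtain s where s: "s \<in> J" "x s \<notin> S" by blast
    then have "0 \<le> s" "0 \<le> T - s" using J(2) by auto
    then have "X s \<omega> \<noteq> x s" "X (T - s) \<omega> \<noteq> x s" if "\<omega> \<in> space \<Omega>" for \<omega>
      using X_in_S[OF \<open>0 \<le> s\<close> that] X_in_S[OF \<open>0 \<le> T - s\<close> that] s(2) by auto
    then have "visits ps = {}" "visits qs = {}"
      unfolding ps[symmetric] qs[symmetric] using s(1) by auto
    then show ?thesis by simp
  qed
  then show "prob_from S P \<mu> {\<omega>\<in>space \<Omega>. \<forall>s\<in>J. X s \<omega> = x s}
      = prob_from S P \<mu> {\<omega>\<in>space \<Omega>. \<forall>s\<in>J. X (T - s) \<omega> = x s}"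
    unfolding ps qs .
qed

text \<open>Uniqueness uses invariance at time 1 only, where every entry of the kernel is
  positive.\<close>

lemma stationary_iff:
  assumes pos: "\<And>x. x \<in> S \<Longrightarrow> 0 < \<mu> x" and zero: "\<And>x. x \<notin> S \<Longrightarrow> \<mu> x = 0"
    and total: "(\<Sum>x\<in>S. \<mu> x) = 1"
    and p_pos: "\<And>a b. a \<in> S \<Longrightarrow> b \<in> S \<Longrightarrow> 0 < p 1 a b"
  shows "stationary_distribution S \<Omega> P X \<nu> \<longleftrightarrow> \<nu> = \<mu>"
proof
  have ev: "prob_from S P \<kappa> {\<omega>\<in>space \<Omega>. X t \<omega> = z} = (\<Sum>x\<in>S. \<kappa> x * p t x z)"
    if "z \<in> S" "0 \<le> t" for \<kappa> z t
    using that by (simp add: prob_from_def transition_eq_measure visits_def)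
  show "stationary_distribution S \<Omega> P X \<nu>" if "\<nu> = \<mu>"
    unfolding stationary_distribution_def
    using that zero total p_invariant ev pos by (auto intro: less_imp_le) (metis less_imp_le order_refl)
  assume st: "stationary_distribution S \<Omega> P X \<nu>"
  have ne: "S \<noteq> {}" using total by auto
  define f where "f x = \<nu> x / \<mu> x" for x
  have \<nu>: "\<nu> x = f x * \<mu> x" if "x \<in> S" for x using pos[OF that] by (simp add: f_def)
  txt \<open>By reversibility the density of \<open>\<nu>\<close> is harmonic, so that the maximum principle applies.\<close>
  have harm: "(\<Sum>x\<in>S. p 1 z x * f x) = f z" if "z \<in> S" for z
  proof -
    have "\<mu> z * (\<Sum>x\<in>S. p 1 z x * f x) = (\<Sum>x\<in>S. f x * (\<mu> z * p 1 z x))"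
      by (simp add: sum_distrib_left mult_ac)
    also have "\<dots> = (\<Sum>x\<in>S. f x * (\<mu> x * p 1 x z))"
      using that by (intro sum.cong) (auto simp: p_balance)
    also have "\<dots> = (\<Sum>x\<in>S. \<nu> x * p 1 x z)"
      by (intro sum.cong) (auto simp: \<nu>)
    also have "\<dots> = \<nu> z"
      using st that ev[OF that, of 1 \<nu>] by (auto simp: stationary_distribution_def)
    also have "\<dots> = \<mu> z * f z" using \<nu>[OF that] by simp
    finally show ?thesis using pos[OF that] by simp
  qed
  obtain m where m: "m \<in> S" "\<And>x. x \<in> S \<Longrightarrow> f x \<le> f m"
  proof -
    have "Max (f ` S) \<in> f ` S" using finite_S ne by simp
    then obtain m where "m \<in> S" "Max (f ` S) = f m" by auto
    then show ?thesis using that Max_ge finite_S by (metis finite_imageI imageI)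
  qed
  \<comment> \<open>At a maximum \<open>m\<close> of \<open>f\<close>, harmonicity makes the average
    of the nonnegative differences \<open>f m - f x\<close> vanish. All averaging weights are
    positive, so each difference is 0.\<close>
  have "(\<Sum>x\<in>S. p 1 m x * (f m - f x)) = (\<Sum>x\<in>S. p 1 m x) * f m - (\<Sum>x\<in>S. p 1 m x * f x)"
    by (simp add: sum_subtractf right_diff_distrib sum_distrib_right)
  then have "(\<Sum>x\<in>S. p 1 m x * (f m - f x)) = 0"
    using harm[OF m(1)] transition_sum[OF m(1), of 1] by simp
  moreover have "0 \<le> p 1 m x * (f m - f x)" if "x \<in> S" for x
    using m(2)[OF that] p_pos[OF m(1) that] by simp
  ultimately have "\<forall>x\<in>S. p 1 m x * (f m - f x) = 0"
    using finite_S by (simp only: sum_nonneg_eq_0_iff)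
  then have const: "f x = f m" if "x \<in> S" for x
    using p_pos[OF m(1) that] that by auto
  \<comment> \<open>Both distributions have total mass 1, which fixes the constant density.\<close>
  have "(\<Sum>x\<in>S. \<nu> x) = f m * (\<Sum>x\<in>S. \<mu> x)"
    by (simp add: sum_distrib_left \<nu> const cong: sum.cong)
  then have "f m = 1" using st total by (simp add: stationary_distribution_def)
  then show "\<nu> = \<mu>"
    using \<nu> const zero st by (intro ext) (metis mult_1 stationary_distribution_def)
qed

end


section \<open>The network\<close>

declare weight.simps [simp del] jump_rate.simps [simp del]

lemma gamma_bar_Suc: "gamma_bar \<gamma> i (Suc n) = gamma_bar \<gamma> i n * \<gamma> i n"
  by (simp add: gamma_bar_def)

lemma weight_eq: "weight \<gamma> \<xi> \<eta> (y, n) = (\<Prod>q\<in>y. \<xi> q / \<eta> q * gamma_bar \<gamma> q (n q))"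
proof -
  have "weight \<gamma> \<xi> \<eta> (y, n) = (\<Prod>q\<in>UNIV. if q \<in> y then \<xi> q / \<eta> q * gamma_bar \<gamma> q (n q) else 1)"
    by (auto simp: weight.simps intro!: prod.cong)
  then show ?thesis by (simp flip: prod.inter_restrict)
qed

lemma weight_insert:
  "k \<notin> y \<Longrightarrow> weight \<gamma> \<xi> \<eta> (insert k y, n)
     = \<xi> k / \<eta> k * gamma_bar \<gamma> k (n k) * weight \<gamma> \<xi> \<eta> (y, n)"
  unfolding weight_eq by simp

lemma weight_upd_Suc:
  "weight \<gamma> \<xi> \<eta> (y, n(q := Suc v)) = weight \<gamma> \<xi> \<eta> (y, n(q := v)) * (if q \<in> y then \<gamma> q v else 1)"
proof -
  have "(\<Prod>p\<in>y - {q}. \<xi> p / \<eta> p * gamma_bar \<gamma> p ((n(q := a)) p))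
      = (\<Prod>p\<in>y - {q}. \<xi> p / \<eta> p * gamma_bar \<gamma> p (n p))" for a
    by (intro prod.cong) auto
  then show ?thesis
    unfolding weight_eq
    by (cases "q \<in> y") (auto simp: prod.remove[of y q] gamma_bar_Suc intro!: prod.cong)
qed

text \<open>A move passes through the configuration \<open>n(i := n i - 1)\<close> in which the moved task is absent.\<close>

lemma move_through:
  assumes "i \<noteq> k" "n i \<ge> 1"
  shows "n = (n(i := n i - 1))(i := Suc (n i - 1))" "n(i := n i - 1) = (n(i := n i - 1))(i := n i - 1)"
    "move i k n = (n(i := n i - 1))(k := Suc (n k))" "n(i := n i - 1) = (n(i := n i - 1))(k := n k)"
  using assms by (auto simp: move_def fun_eq_iff)

text \<open>Both configurations arise by adding one task to the same configuration, at
  \<open>i\<close> or at \<open>k\<close>. The ratio of weights is stated by cross-multiplication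
  since values of \<open>\<gamma>\<close> may vanish.\<close>

lemma weight_move:
  assumes "i \<noteq> k" "n i \<ge> 1"
  shows "weight \<gamma> \<xi> \<eta> (y, move i k n) * (if i \<in> y then \<gamma> i (n i - 1) else 1)
       = weight \<gamma> \<xi> \<eta> (y, n) * (if k \<in> y then \<gamma> k (n k) else 1)"
proof -
  define m where "m = n(i := n i - 1)"
  note m = move_through[of i k n, OF assms, folded m_def]
  have "weight \<gamma> \<xi> \<eta> (y, n) = weight \<gamma> \<xi> \<eta> (y, m) * (if i \<in> y then \<gamma> i (n i - 1) else 1)"
    using weight_upd_Suc[of \<gamma> \<xi> \<eta> y m i "n i - 1"] unfolding m(1,2)[symmetric] .
  moreover have "weight \<gamma> \<xi> \<eta> (y, move i k n) = weight \<gamma> \<xi> \<eta> (y, m) * (if k \<in> y then \<gamma> k (n k) else 1)"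
    using weight_upd_Suc[of \<gamma> \<xi> \<eta> y m k "n k"] unfolding m(3,4)[symmetric] .
  ultimately show ?thesis by simp
qed

lemma move_at:
  assumes "i \<noteq> k"
  shows "move i k n i = n i - 1" "move i k n k = n k + 1"
  using assms by (auto simp: move_def)

text \<open>The move from \<open>k\<close> to \<open>i\<close> undoes the one from \<open>i\<close>
  to \<open>k\<close>. This matches the indicators in a rate with those in the rate of the reverse
  jump.\<close>

lemma move_iff:
  assumes "i \<noteq> k"
  shows "1 \<le> n i \<and> n' = move i k n \<longleftrightarrow> 1 \<le> n' k \<and> n = move k i n'"
  using assms by (auto simp: move_def fun_eq_iff)

lemma states_iff: "(y, n) \<in> states N \<longleftrightarrow> (\<Sum>s\<in>UNIV. n s) = N"
  by (simp add: states_def)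

lemma states_move:
  assumes "(y, n) \<in> states N" "i \<noteq> k" "n i \<ge> 1"
  shows "(y', move i k n) \<in> states N"
proof -
  have Suc: "(\<Sum>s\<in>UNIV. (f(q := Suc v)) s) = Suc (\<Sum>s\<in>UNIV. (f(q := v)) s)" for f :: "'a \<Rightarrow> nat" and q v
  proof -
    have "(\<Sum>s\<in>UNIV - {q}. (f(q := Suc v)) s) = (\<Sum>s\<in>UNIV - {q}. (f(q := v)) s)"
      by (intro sum.cong) auto
    then show ?thesis by (simp add: sum.remove[of UNIV q])
  qed
  define m where "m = n(i := n i - 1)"
  note m = move_through[of i k n, OF assms(2,3), folded m_def]
  have "(\<Sum>s\<in>UNIV. n s) = Suc (\<Sum>s\<in>UNIV. m s)"
    using Suc[of m i "n i - 1"] unfolding m(1,2)[symmetric] .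
  moreover have "(\<Sum>s\<in>UNIV. move i k n s) = Suc (\<Sum>s\<in>UNIV. m s)"
    using Suc[of m k "n k"] unfolding m(3,4)[symmetric] .
  ultimately show ?thesis using assms(1) by (simp add: states_iff)
qed

section \<open>Matching of sums with indicators\<close>

lemma sum_sum_restrict:
  fixes f :: "'a::finite \<Rightarrow> 'b::finite \<Rightarrow> real"
  shows "(\<Sum>a\<in>A. \<Sum>b\<in>B a. f a b) = (\<Sum>a\<in>UNIV. \<Sum>b\<in>UNIV. if a \<in> A \<and> b \<in> B a then f a b else 0)"
proof -
  have "(\<Sum>b\<in>UNIV. if a \<in> A \<and> b \<in> B a then f a b else 0) = (if a \<in> A then \<Sum>b\<in>B a. f a b else 0)" for a
    using sum.inter_restrict[of UNIV "f a" "B a"] by auto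
  then show ?thesis using sum.inter_restrict[of UNIV "\<lambda>a. \<Sum>b\<in>B a. f a b" A] by simp
qed

text \<open>Each group of jump rates is a sum over pairs of sites, and the reverse jump exchanges
  the two sites. Detailed balance for a group thus reduces to the summands whose indicator is
  1.\<close>

lemma sum_sum_of_bool_swap_eq:
  fixes f :: "'a::finite \<Rightarrow> 'b::finite \<Rightarrow> real"
  assumes iff: "\<And>a b. a \<in> A \<and> b \<in> B a \<and> p a b \<longleftrightarrow> b \<in> B' \<and> a \<in> A' b \<and> q b a"
    and eq: "\<And>a b. a \<in> A \<Longrightarrow> b \<in> B a \<Longrightarrow> p a b \<Longrightarrow> c * f a b = d * g b a"
  shows "c * (\<Sum>a\<in>A. \<Sum>b\<in>B a. f a b * of_bool (p a b))
       = d * (\<Sum>b\<in>B'. \<Sum>a\<in>A' b. g b a * of_bool (q b a))"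
proof -
  have *: "(if a \<in> A \<and> b \<in> B a then c * (f a b * of_bool (p a b)) else 0)
      = (if b \<in> B' \<and> a \<in> A' b then d * (g b a * of_bool (q b a)) else 0)" for a b
    using iff[of a b] eq[of a b] by (cases "p a b"; cases "q b a") auto
  have "c * (\<Sum>a\<in>A. \<Sum>b\<in>B a. f a b * of_bool (p a b))
      = (\<Sum>a\<in>UNIV. \<Sum>b\<in>UNIV. if b \<in> B' \<and> a \<in> A' b then d * (g b a * of_bool (q b a)) else 0)"
    unfolding sum_distrib_left by (subst sum_sum_restrict) (simp only: *)
  also have "\<dots> = d * (\<Sum>b\<in>B'. \<Sum>a\<in>A' b. g b a * of_bool (q b a))"
    unfolding sum_distrib_left by (subst sum.swap) (rule sum_sum_restrict[symmetric])
  finally show ?thesis .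
qed

lemma sum_of_bool_eq:
  fixes f g :: "'a::finite \<Rightarrow> real"
  assumes iff: "\<And>a. a \<in> A \<and> p a \<longleftrightarrow> a \<in> B \<and> q a"
    and eq: "\<And>a. a \<in> A \<Longrightarrow> p a \<Longrightarrow> c * f a = d * g a"
  shows "c * (\<Sum>a\<in>A. f a * of_bool (p a)) = d * (\<Sum>a\<in>B. g a * of_bool (q a))"
proof -
  have "c * (\<Sum>a\<in>A. \<Sum>b\<in>{()}. f a * of_bool (p a)) = d * (\<Sum>b\<in>{()}. \<Sum>a\<in>B. g a * of_bool (q a))"
    by (rule sum_sum_of_bool_swap_eq) (use iff eq in blast)+
  then show ?thesis by simp
qed

section \<open>Detailed balance of the network\<close>

locale network =
  fixes \<gamma> :: "'s::finite \<Rightarrow> nat \<Rightarrow> real"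
    and \<xi> \<eta> :: "'s \<Rightarrow> real"
    and \<beta> \<theta> \<epsilon> :: "'s \<Rightarrow> 's \<Rightarrow> nat \<Rightarrow> nat \<Rightarrow> 's set \<Rightarrow> real"
    and \<tau> :: "'s \<Rightarrow> 's \<Rightarrow> ('s \<Rightarrow> nat) \<Rightarrow> 's set \<Rightarrow> real"
    and N :: nat
  assumes gamma_nonneg: "\<And>i n. \<gamma> i n \<ge> 0"
    and gamma_bar_pos: "\<And>y n j. (y, n) \<in> states N \<Longrightarrow> j \<in> y \<Longrightarrow> gamma_bar \<gamma> j (n j) > 0"
    and xi_pos: "\<And>k. \<xi> k > 0"
    and eta_pos: "\<And>k. \<eta> k > 0"
    and beta_pos: "\<And>k l a b y. k \<noteq> l \<Longrightarrow> k \<notin> y \<Longrightarrow> l \<notin> y \<Longrightarrow> \<beta> k l a b y > 0"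
    and theta_pos: "\<And>j k a b y. j \<in> y \<Longrightarrow> k \<notin> y \<Longrightarrow> \<theta> j k a b y > 0 \<and> \<theta> k j a b y > 0"
    and epsilon_pos: "\<And>i j a b y. i \<noteq> j \<Longrightarrow> i \<in> y \<Longrightarrow> j \<in> y \<Longrightarrow> \<epsilon> i j a b y > 0"
    and tau_pos: "\<And>j j' n y. j \<in> y \<Longrightarrow> j' \<notin> y \<Longrightarrow> \<tau> j j' n y > 0"
    and beta_balance:
      "\<And>k l n y. k \<noteq> l \<Longrightarrow> k \<notin> y \<Longrightarrow> l \<notin> y \<Longrightarrow> n k \<ge> 1 \<Longrightarrow>
         \<beta> k l (n k) (n l) y = \<beta> l k (n l + 1) (n k - 1) y"
    and theta_balance:
      "\<And>j k n y. j \<in> y \<Longrightarrow> k \<notin> y \<Longrightarrow> n j \<ge> 1 \<Longrightarrow>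
         \<theta> j k (n j) (n k) y = \<theta> k j (n k + 1) (n j - 1) y"
    and epsilon_balance:
      "\<And>i j n y. i \<noteq> j \<Longrightarrow> i \<in> y \<Longrightarrow> j \<in> y \<Longrightarrow> n i \<ge> 1 \<Longrightarrow>
         \<epsilon> i j (n i) (n j) y * \<gamma> i (n i - 1) = \<gamma> j (n j) * \<epsilon> j i (n j + 1) (n i - 1) y"
    and tau_balance:
      "\<And>j j' n y. j \<in> y \<Longrightarrow> j' \<notin> y \<Longrightarrow>
         \<tau> j j' n y * (\<xi> j / \<eta> j) = \<tau> j' j n (insert j' (y - {j})) * (\<xi> j' / \<eta> j')"
begin

abbreviation "rate \<equiv> jump_rate \<gamma> \<xi> \<eta> \<beta> \<theta> \<epsilon> \<tau>"
abbreviation "W \<equiv> weight \<gamma> \<xi> \<eta>"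
abbreviation "gb \<equiv> gamma_bar \<gamma>"

lemma gb_nonneg: "0 \<le> gb k m"
  by (simp add: gamma_bar_def gamma_nonneg prod_nonneg)

text \<open>The value in question is the last factor of a positive product of nonnegative
  numbers.\<close>

lemma gamma_prev_pos:
  assumes "(y, n) \<in> states N" "i \<in> y" "n i \<ge> 1"
  shows "0 < \<gamma> i (n i - 1)"
proof -
  have "0 < gb i (Suc (n i - 1))" using gamma_bar_pos[OF assms(1,2)] assms(3) by simp
  then show ?thesis
    unfolding gamma_bar_Suc using gb_nonneg[of i "n i - 1"] gamma_nonneg[of i "n i - 1"]
    by (simp add: zero_less_mult_iff)
qed

lemma weight_pos: "x \<in> states N \<Longrightarrow> 0 < W x"
  using gamma_bar_pos xi_pos eta_pos by (cases x) (auto simp: weight_eq intro!: prod_pos)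

text \<open>Unoccupied sites do not enter the weight, so the move leaves it unchanged.\<close>

lemma beta_term:
  assumes "k \<noteq> l" "k \<notin> y" "l \<notin> y" "1 \<le> n k"
  shows "W (y, n) * \<beta> k l (n k) (n l) y
       = W (y, move k l n) * \<beta> l k (move k l n l) (move k l n k) y"
proof -
  have "W (y, n) = W (y, move k l n)"
    using weight_move[of k l n \<gamma> \<xi> \<eta> y] assms by simp
  moreover have "\<beta> k l (n k) (n l) y = \<beta> l k (move k l n l) (move k l n k) y"
    unfolding move_at[OF assms(1)] by (rule beta_balance) (use assms in auto)
  ultimately show ?thesis by simp
qed

text \<open>The balance of \<open>\<epsilon>\<close> and the change of weight combine to the claim
  multiplied by \<open>\<gamma> i (n i - 1)\<close>, which is positive and cancels.\<close>

lemma epsilon_term: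
  assumes "i \<noteq> j" "i \<in> y" "j \<in> y" "1 \<le> n i" "(y, n) \<in> states N"
  shows "W (y, n) * \<epsilon> i j (n i) (n j) y
       = W (y, move i j n) * \<epsilon> j i (move i j n j) (move i j n i) y"
proof -
  have "0 < \<gamma> i (n i - 1)" using gamma_prev_pos assms by blast
  moreover have "W (y, n) * \<epsilon> i j (n i) (n j) y * \<gamma> i (n i - 1)
      = W (y, move i j n) * \<epsilon> j i (n j + 1) (n i - 1) y * \<gamma> i (n i - 1)"
    using epsilon_balance[of i j y n] weight_move[of i j n \<gamma> \<xi> \<eta> y] assms
    by (simp add: mult_ac)
  ultimately show ?thesis using assms(1) by (simp add: move_at)
qed

text \<open>By leaving the occupied site \<open>j\<close> the task takes the factor
  \<open>\<gamma> j (n j - 1)\<close> out of the weight; this is the extra factor in the rate of the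
  reverse move.\<close>

lemma theta_term:
  assumes "j \<in> y" "l \<notin> y" "1 \<le> n j"
  shows "W (y, n) * \<theta> j l (n j) (n l) y
       = W (y, move j l n) * (\<theta> l j (move j l n l) (move j l n j) y * \<gamma> j (move j l n j))"
proof -
  have "j \<noteq> l" using assms by auto
  then show ?thesis
    using weight_move[of j l n \<gamma> \<xi> \<eta> y] theta_balance[of j y l n] assms
    by (simp add: move_at mult_ac)
qed

text \<open>Both weights are expressed through that of \<open>y - {j}\<close>. The reciprocals in
  the rates cancel the factors \<open>gb\<close>, and the balance of \<open>\<tau>\<close> is
  left.\<close>

lemma tau_term:
  assumes "j \<in> y" "j' \<notin> y" "(y, n) \<in> states N"
  defines "y' \<equiv> insert j' (y - {j})"
  shows "W (y, n) * (inverse (gb j (n j)) * \<tau> j j' n y)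
       = W (y', n) * (inverse (gb j' (n j')) * \<tau> j' j n y')"
proof -
  have "y = insert j (y - {j})" using assms by auto
  then have 1: "W (y, n) = \<xi> j / \<eta> j * gb j (n j) * W (y - {j}, n)"
    by (metis Diff_iff singletonI weight_insert)
  have 2: "W (y', n) = \<xi> j' / \<eta> j' * gb j' (n j') * W (y - {j}, n)"
    unfolding y'_def using assms(2) by (simp add: weight_insert)
  have "(y', n) \<in> states N" "j' \<in> y'" using assms(3) by (auto simp: states_iff y'_def)
  then have "gb j' (n j') > 0" "gb j (n j) > 0" using gamma_bar_pos assms by blast+
  then have "W (y, n) * (inverse (gb j (n j)) * \<tau> j j' n y) = \<tau> j j' n y * (\<xi> j / \<eta> j) * W (y - {j}, n)"
    and "W (y', n) * (inverse (gb j' (n j')) * \<tau> j' j n y') = \<tau> j' j n y' * (\<xi> j' / \<eta> j') * W (y - {j}, n)"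
    unfolding 1 2 by simp_all
  then show ?thesis using tau_balance[OF assms(1,2), of n, folded y'_def] by (simp only:)
qed

lemma detailed_balance:
  assumes "x \<in> states N" "z \<in> states N"
  shows "W x * rate x z = W z * rate z x"
proof -
  obtain y n y' n' where xz: "x = (y, n)" "z = (y', n')" by fastforce
  note st = assms[unfolded xz]
  let ?B = "\<lambda>y n y' n'. \<Sum>k\<in>-y. \<Sum>l\<in>-y - {k}.
        \<beta> k l (n k) (n l) y * of_bool (n k \<ge> 1 \<and> y' = y \<and> n' = move k l n)"
  let ?E = "\<lambda>y n y' n'. \<Sum>i\<in>y. \<Sum>j\<in>y - {i}.
        \<epsilon> i j (n i) (n j) y * of_bool (n i \<ge> 1 \<and> y' = y \<and> n' = move i j n)"
  let ?T = "\<lambda>y n y' n'. \<Sum>j\<in>y. \<Sum>l\<in>-y.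
        \<theta> j l (n j) (n l) y * of_bool (n j \<ge> 1 \<and> y' = y \<and> n' = move j l n)"
  let ?T' = "\<lambda>y n y' n'. \<Sum>j\<in>y. \<Sum>k\<in>-y.
        \<theta> k j (n k) (n j) y * \<gamma> j (n j) * of_bool (n k \<ge> 1 \<and> y' = y \<and> n' = move k j n)"
  let ?J = "\<lambda>y n y' n'. \<Sum>j\<in>y. \<Sum>j'\<in>-y.
        inverse (gamma_bar \<gamma> j (n j)) * \<tau> j j' n y * of_bool (y' = insert j' (y - {j}) \<and> n' = n)"
  let ?A = "\<lambda>y n y' n'. \<Sum>k\<in>-y. \<xi> k * gamma_bar \<gamma> k (n k) * of_bool (y' = insert k y \<and> n' = n)"
  let ?D = "\<lambda>y n y' n'. \<Sum>i\<in>y. \<eta> i * of_bool (y' = y - {i} \<and> n' = n)"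
  have B: "W (y, n) * ?B y n y' n' = W (y', n') * ?B y' n' y n"
  proof (rule sum_sum_of_bool_swap_eq, goal_cases)
    case (1 k l)
    show ?case using move_iff[of k l n n'] by blast
  next
    case (2 k l)
    then show ?case using beta_term[of k l y n] by auto
  qed
  have E: "W (y, n) * ?E y n y' n' = W (y', n') * ?E y' n' y n"
  proof (rule sum_sum_of_bool_swap_eq, goal_cases)
    case (1 i j)
    show ?case using move_iff[of i j n n'] by blast
  next
    case (2 i j)
    then show ?case using epsilon_term[of i j y n] st(1) by auto
  qed
  \<comment> \<open>The two kinds of \<open>\<theta>\<close> moves reverse each other. The states
    are quantified because the identity is used in both directions; the initial swap of sums gives
    the order that the matching reverses.\<close>
  have T: "W (y, n) * ?T y n y' n' = W (y', n') * ?T' y' n' y n" for y n y' n'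
  proof (subst sum.swap, rule sum_sum_of_bool_swap_eq, goal_cases)
    case (1 l j)
    show ?case using move_iff[of j l n n'] by blast
  next
    case (2 l j)
    then show ?case using theta_term[of j y l n] by auto
  qed
  have J: "W (y, n) * ?J y n y' n' = W (y', n') * ?J y' n' y n"
  proof (rule sum_sum_of_bool_swap_eq, goal_cases)
    case (1 j j')
    show ?case by auto
  next
    case (2 j j')
    then show ?case using tau_term[of j y j' n] st(1) by simp
  qed
  have A: "W (y, n) * ?A y n y' n' = W (y', n') * ?D y' n' y n" for y n y' n'
  proof (rule sum_of_bool_eq, goal_cases)
    case (1 k)
    show ?case by blast
  next
    case (2 k)
    then show ?case using eta_pos[of k] by (simp add: weight_insert)
  qed
  show ?thesis
    unfolding xz jump_rate.simps distrib_left B E J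
      T[of y n y' n'] T[of y' n' y n, symmetric] A[of y n y' n'] A[of y' n' y n, symmetric]
    by (simp only: add_ac)
qed

section \<open>Irreducibility of the network\<close>

text \<open>All groups of rates are nonnegative. The two kept here, moves between unoccupied sites
  and departures, suffice to connect the states.\<close>

lemma rate_ge:
  assumes "(y, n) \<in> states N"
  shows "(\<Sum>k\<in>-y. \<Sum>l\<in>-y - {k}. \<beta> k l (n k) (n l) y * of_bool (n k \<ge> 1 \<and> y' = y \<and> n' = move k l n))
      + (\<Sum>i\<in>y. \<eta> i * of_bool (y' = y - {i} \<and> n' = n)) \<le> rate (y, n) (y', n')"
proof -
  have "0 \<le> (\<Sum>i\<in>y. \<Sum>j\<in>y - {i}. \<epsilon> i j (n i) (n j) y * of_bool (n i \<ge> 1 \<and> y' = y \<and> n' = move i j n))"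
    by (intro sum_nonneg mult_nonneg_nonneg) (auto intro!: less_imp_le epsilon_pos)
  moreover have "0 \<le> (\<Sum>j\<in>y. \<Sum>l\<in>-y. \<theta> j l (n j) (n l) y * of_bool (n j \<ge> 1 \<and> y' = y \<and> n' = move j l n))"
    using theta_pos by (intro sum_nonneg mult_nonneg_nonneg) (auto intro!: less_imp_le)
  moreover have "0 \<le> (\<Sum>j\<in>y. \<Sum>k\<in>-y. \<theta> k j (n k) (n j) y * \<gamma> j (n j) * of_bool (n k \<ge> 1 \<and> y' = y \<and> n' = move k j n))"
    using theta_pos by (intro sum_nonneg mult_nonneg_nonneg gamma_nonneg) (auto intro!: less_imp_le)
  moreover have "0 \<le> (\<Sum>j\<in>y. \<Sum>j'\<in>-y. inverse (gb j (n j)) * \<tau> j j' n y * of_bool (y' = insert j' (y - {j}) \<and> n' = n))"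
    using tau_pos gb_nonneg by (intro sum_nonneg mult_nonneg_nonneg) (auto intro!: less_imp_le)
  moreover have "0 \<le> (\<Sum>k\<in>-y. \<xi> k * gb k (n k) * of_bool (y' = insert k y \<and> n' = n))"
    using xi_pos gb_nonneg by (intro sum_nonneg mult_nonneg_nonneg) (auto intro!: less_imp_le)
  ultimately show ?thesis unfolding jump_rate.simps by linarith
qed

abbreviation "edges \<equiv> {(x, z). x \<in> states N \<and> z \<in> states N \<and> x \<noteq> z \<and> rate x z > 0}"

lemma edge_remove:
  assumes "(y, n) \<in> states N" "i \<in> y"
  shows "((y, n), (y - {i}, n)) \<in> edges"
proof -
  have "0 < (\<Sum>k\<in>y. \<eta> k * of_bool (y - {i} = y - {k} \<and> n = n))"
    using assms(2) eta_pos by (intro sum_pos2[of _ i]) (auto intro: less_imp_le)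
  moreover have "0 \<le> (\<Sum>k\<in>-y. \<Sum>l\<in>-y - {k}. \<beta> k l (n k) (n l) y * of_bool (n k \<ge> 1 \<and> y - {i} = y \<and> n = move k l n))"
    by (intro sum_nonneg mult_nonneg_nonneg) (auto intro!: less_imp_le beta_pos)
  ultimately have "0 < rate (y, n) (y - {i}, n)" using rate_ge[OF assms(1), of "y - {i}" n] by linarith
  then show ?thesis using assms by (auto simp: states_iff)
qed

lemma edge_move:
  assumes "({}, n) \<in> states N" "i \<noteq> k" "n i \<ge> 1"
  shows "(({}, n), ({}, move i k n)) \<in> edges"
proof -
  have "0 < (\<Sum>a\<in>UNIV. \<Sum>b\<in>UNIV - {a}. \<beta> a b (n a) (n b) {} * of_bool (n a \<ge> 1 \<and> {} = {} \<and> move i k n = move a b n))"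
  proof (rule sum_pos2[of _ i])
    show "0 < (\<Sum>b\<in>UNIV - {i}. \<beta> i b (n i) (n b) {} * of_bool (n i \<ge> 1 \<and> {} = {} \<and> move i k n = move i b n))"
      using assms beta_pos by (intro sum_pos2[of _ k]) (auto intro!: mult_nonneg_nonneg beta_pos[THEN less_imp_le])
  qed (auto intro!: sum_nonneg mult_nonneg_nonneg beta_pos[THEN less_imp_le])
  then have "0 < rate ({}, n) ({}, move i k n)" using rate_ge[OF assms(1), of "{}" "move i k n"] by simp
  moreover have "n \<noteq> move i k n" using assms(2) by (auto simp: fun_eq_iff move_def)
  ultimately show ?thesis using assms states_move[OF assms] by auto
qed

lemma edges_sym: "sym edges"
proof (rule symI)
  fix x z assume xz: "(x, z) \<in> edges"
  then have "0 < W x * rate x z" by (auto simp: weight_pos)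
  then have "0 < W z * rate z x" using detailed_balance xz by auto
  then show "(z, x) \<in> edges" using xz weight_pos[of z] by (auto simp: zero_less_mult_iff)
qed

lemma reaches_empty:
  assumes "(y, n) \<in> states N"
  shows "((y, n), ({}, n)) \<in> edges\<^sup>*"
proof -
  have "finite y" by simp
  then show ?thesis using assms
  proof (induction y)
    case (insert i y)
    then have "((insert i y, n), (y, n)) \<in> edges"
      using edge_remove[of "insert i y" n i] by simp
    moreover have "((y, n), ({}, n)) \<in> edges\<^sup>*" using insert by (simp add: states_iff)
    ultimately show ?case by (rule converse_rtrancl_into_rtrancl)
  qed simp
qed

text \<open>Tasks are brought to \<open>s\<close> one by one; each move lowers
  \<open>N - n s\<close>, the number of tasks elsewhere.\<close>

lemma reaches_stack:
  assumes "({}, n) \<in> states N"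
  shows "(({}, n), ({}, (\<lambda>_. 0)(s := N))) \<in> edges\<^sup>*"
  using assms
proof (induction "N - n s" arbitrary: n rule: less_induct)
  case less
  have sum: "n s + (\<Sum>k\<in>UNIV - {s}. n k) = N"
    using less.prems by (simp add: states_iff sum.remove[of UNIV s])
  show ?case
  proof (cases "\<forall>k. k \<noteq> s \<longrightarrow> n k = 0")
    case True
    then have "n = (\<lambda>_. 0)(s := N)" using sum by (auto simp: fun_eq_iff)
    then show ?thesis by simp
  next
    case False
    then obtain k where k: "k \<noteq> s" "n k \<ge> 1" by (auto simp: Suc_le_eq)
    have "n k \<le> (\<Sum>k\<in>UNIV - {s}. n k)" using k by (intro member_le_sum) auto
    then have "N - move k s n s < N - n s" using k sum move_at[OF k(1)] by simp
    then have "(({}, move k s n), ({}, (\<lambda>_. 0)(s := N))) \<in> edges\<^sup>*"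
      using states_move[OF less.prems k] by (rule less.hyps)
    then show ?thesis using edge_move[OF less.prems k] by (rule converse_rtrancl_into_rtrancl[rotated])
  qed
qed

lemma irreducible:
  assumes "x \<in> states N" "z \<in> states N"
  shows "(x, z) \<in> edges\<^sup>*"
proof -
  \<comment> \<open>Any fixed site may collect the tasks; \<open>undefined\<close> merely names
    one.\<close>
  have *: "(x, ({}, (\<lambda>_. 0)(undefined := N))) \<in> edges\<^sup>*" if "x \<in> states N" for x
  proof (cases x)
    case (Pair y n)
    then have "({}, n) \<in> states N" using that by (simp add: states_iff)
    then show ?thesis using reaches_empty[of y n] reaches_stack[of n] that Pair by (meson rtrancl_trans)
  qed
  have "(({}, (\<lambda>_. 0)(undefined := N)), z) \<in> edges\<^sup>*"
    using *[OF assms(2)] sym_rtrancl[OF edges_sym] by (meson symD)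
  then show ?thesis using *[OF assms(1)] by (rule rtrancl_trans[rotated])
qed

end

section \<open>Recurrence, reversibility and stationary law of the network process\<close>

theorem theorem4p4:
  fixes \<gamma> :: "'s::finite \<Rightarrow> nat \<Rightarrow> real"
    and \<xi> \<eta> :: "'s \<Rightarrow> real"
    and \<beta> \<theta> \<epsilon> :: "'s \<Rightarrow> 's \<Rightarrow> nat \<Rightarrow> nat \<Rightarrow> 's set \<Rightarrow> real"
    and \<tau> :: "'s \<Rightarrow> 's \<Rightarrow> ('s \<Rightarrow> nat) \<Rightarrow> 's set \<Rightarrow> real"
    and N :: nat
    and R :: "'s state \<Rightarrow> 's state \<Rightarrow> real"
    and \<Omega> :: "'w measure"
    and P :: "'s state \<Rightarrow> 'w measure"
    and X :: "real \<Rightarrow> 'w \<Rightarrow> 's state"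
  assumes gamma_nonneg: "\<And>i n. \<gamma> i n \<ge> 0"
    and gamma_0: "\<And>i. \<gamma> i 0 = 1"
    and gamma_pos: "\<And>i n. \<gamma> i (n + 1) > 0 \<Longrightarrow> \<gamma> i n > 0"
    and gamma_bar_pos: "\<And>y n j. (y, n) \<in> states N \<Longrightarrow> j \<in> y \<Longrightarrow> gamma_bar \<gamma> j (n j) > 0"
    and xi_pos: "\<And>k. \<xi> k > 0"
    and eta_pos: "\<And>k. \<eta> k > 0"
    and beta_irreducible:
      "\<And>k l a b y. k \<noteq> l \<Longrightarrow> k \<notin> y \<Longrightarrow> l \<notin> y \<Longrightarrow> \<beta> k l a b y > 0"
    and theta_irreducible:
      "\<And>j k a b y. j \<in> y \<Longrightarrow> k \<notin> y \<Longrightarrow> \<theta> j k a b y > 0 \<and> \<theta> k j a b y > 0"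
    and epsilon_irreducible:
      "\<And>i j a b y. i \<noteq> j \<Longrightarrow> i \<in> y \<Longrightarrow> j \<in> y \<Longrightarrow> \<epsilon> i j a b y > 0"
    and tau_irreducible:
      "\<And>j j' n y. j \<in> y \<Longrightarrow> j' \<notin> y \<Longrightarrow> \<tau> j j' n y > 0"
    and beta_balance:
      "\<And>k l n y. k \<noteq> l \<Longrightarrow> k \<notin> y \<Longrightarrow> l \<notin> y \<Longrightarrow> n k \<ge> 1 \<Longrightarrow>
         \<beta> k l (n k) (n l) y = \<beta> l k (n l + 1) (n k - 1) y"
    and theta_balance:
      "\<And>j k n y. j \<in> y \<Longrightarrow> k \<notin> y \<Longrightarrow> n j \<ge> 1 \<Longrightarrow>
         \<theta> j k (n j) (n k) y = \<theta> k j (n k + 1) (n j - 1) y"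
    and epsilon_balance:
      "\<And>i j n y. i \<noteq> j \<Longrightarrow> i \<in> y \<Longrightarrow> j \<in> y \<Longrightarrow> n i \<ge> 1 \<Longrightarrow>
         \<epsilon> i j (n i) (n j) y * \<gamma> i (n i - 1) = \<gamma> j (n j) * \<epsilon> j i (n j + 1) (n i - 1) y"
    and tau_balance:
      "\<And>j j' n y. j \<in> y \<Longrightarrow> j' \<notin> y \<Longrightarrow>
         \<tau> j j' n y * (\<xi> j / \<eta> j) = \<tau> j' j n (insert j' (y - {j})) * (\<xi> j' / \<eta> j')"
    and R_def: "R = generator (states N) (jump_rate \<gamma> \<xi> \<eta> \<beta> \<theta> \<epsilon> \<tau>)"
    and Xi_finite: "weight \<gamma> \<xi> \<eta> summable_on states N"
    and process: "markov_process (states N) R \<Omega> P X"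
  shows "positive_recurrent (states N) R P X
       \<and> reversible (states N) \<Omega> P X (equilibrium \<gamma> \<xi> \<eta> N)
       \<and> (\<forall>\<mu>. stationary_distribution (states N) \<Omega> P X \<mu> \<longleftrightarrow> \<mu> = equilibrium \<gamma> \<xi> \<eta> N)"
proof -
  interpret finite_markov_process "states N" R \<Omega> P X
    using process by unfold_locales
  interpret network \<gamma> \<xi> \<eta> \<beta> \<theta> \<epsilon> \<tau> N
    by unfold_locales (fact gamma_nonneg gamma_bar_pos xi_pos eta_pos beta_irreducible
      theta_irreducible epsilon_irreducible tau_irreducible beta_balance theta_balance
      epsilon_balance tau_balance)+
  let ?\<pi> = "equilibrium \<gamma> \<xi> \<eta> N"
  define Z where "Z = partition_function \<gamma> \<xi> \<eta> N"
  have R: "R x z = rate x z" if "x \<noteq> z" for x z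
    using that by (simp add: R_def generator_def)
  have state: "({}, (\<lambda>_. 0)(undefined := N)) \<in> states N"
    by (simp add: states_iff)
  \<comment> \<open>\<open>markov_process\<close> includes finiteness of the state space, so the
    partition function is a finite sum.\<close>
  have Z: "Z = (\<Sum>x\<in>states N. W x)"
    using finite_S by (simp add: Z_def partition_function_def)
  have Z_pos: "0 < Z"
    unfolding Z using finite_S state weight_pos by (intro sum_pos) auto
  have \<pi>: "?\<pi> x = W x / Z" if "x \<in> states N" for x
    using that by (simp add: equilibrium_def Z_def)
  interpret balanced_markov_process "states N" R \<Omega> P X ?\<pi>
  proof
    fix x z :: "'s state" assume xz: "x \<in> states N" "z \<in> states N"
    show "?\<pi> x * R x z = ?\<pi> z * R z x"
      using detailed_balance[OF xz] by (cases "x = z") (auto simp: \<pi> xz R)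
  qed
  \<comment> \<open>\<open>edges\<close> contains only pairs of distinct states, and for these
    \<open>R\<close> agrees with the jump rates.\<close>
  have "edges \<subseteq> {(a, b). a \<in> states N \<and> b \<in> states N \<and> 0 < R a b}"
    by (rule subrelI) (simp add: R)
  then have p_pos: "0 < p 1 a b" if "a \<in> states N" "b \<in> states N" for a b
    using subsetD[OF rtrancl_mono irreducible[OF that]] that(1) by (intro transition_pos) simp_all
  have "\<exists>w\<in>states N. w \<noteq> x" if "x \<in> states N" for x
  proof (cases x)
    case (Pair y n)
    \<comment> \<open>Complementing the set of occupied sites keeps the tasks in place and gives a
      second state, as there is at least one site.\<close>
    have "- y \<noteq> y" by (metis ComplD ComplI UNIV_I)
    then have "(- y, n) \<noteq> x" using Pair by simp
    moreover have "(- y, n) \<in> states N" using that Pair by (simp add: states_iff)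
    ultimately show ?thesis by blast
  qed
  then have "positive_recurrent (states N) R P X"
    using p_pos by (rule positive_recurrentI)
  moreover have "stationary_distribution (states N) \<Omega> P X \<mu> \<longleftrightarrow> \<mu> = ?\<pi>" for \<mu>
  proof (rule stationary_iff)
    show "(\<Sum>x\<in>states N. ?\<pi> x) = 1"
      using Z_pos by (simp add: \<pi> Z flip: sum_divide_distrib)
    show "0 < ?\<pi> x" if "x \<in> states N" for x
      using weight_pos[OF that] Z_pos by (simp add: \<pi>[OF that])
    show "?\<pi> x = 0" if "x \<notin> states N" for x
      using that by (simp add: equilibrium_def)
  qed (rule p_pos)
  ultimately show ?thesis
    by (intro conjI allI reversibleI)
qed

end
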